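(* Let $n\ge 1$, $T>0$, and suppose: $\ell:\mathbb{R}^n\to\mathbb{R}$ is $C^2$, strictly convex, and $\lim_{|u|\to\infty}\ell(u)/|u|=\infty$; $g:\mathbb{R}^n\to\mathbb{R}$ is globally Lipschitz; $d:[0,T]\times[0,T]\to(a,1]$, $(t,s)\mapsto d_t(s)$, with $a>0$, is Lipschitz continuous with $d_t(t)=1$ for each $t$. Then the value function $$v(x,t)=\inf_{y\in \mathrm{AC}_{x,t}}\left\{\int_t^T d_t(s)\,\ell(\dot y(s))\,ds+d_t(T)\,g(y(T))\right\}$$ is locally Lipschitz continuous in $\mathbb{R}^n\times[0,T]$, and $v=g$ on $\mathbb{R}^n\times\{t=T\}$, i.e. $v(x,T)=g(x)$ for all $x\in\mathbb{R}^n$.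
   Context: $\mathrm{AC}_{x,t}$ is the set of absolutely continuous $y:[t,T]\to\mathbb{R}^n$ with $y(t)=x$. Only the values $d_t(s)$ with $t\le s$ enter. *)

theory Defs
  imports "HOL-Analysis.Analysis"
begin

definition C2 :: "('a::euclidean_space \<Rightarrow> real) \<Rightarrow> bool" where
  "C2 f \<longleftrightarrow> (\<exists>(f' :: 'a \<Rightarrow> 'a \<Rightarrow>\<^sub>L real) (f'' :: 'a \<Rightarrow> 'a \<Rightarrow>\<^sub>L ('a \<Rightarrow>\<^sub>L real)).
     (\<forall>x. (f has_derivative blinfun_apply (f' x)) (at x)) \<and>
     (\<forall>x. (f' has_derivative blinfun_apply (f'' x)) (at x)) \<and>
     continuous_on UNIV f'')"

definition strictly_convex_on :: "'a::real_vector set \<Rightarrow> ('a \<Rightarrow> real) \<Rightarrow> bool" where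
  "strictly_convex_on S f \<longleftrightarrow> convex S \<and>
     (\<forall>x\<in>S. \<forall>y\<in>S. \<forall>u>0. \<forall>v>0. x \<noteq> y \<longrightarrow> u + v = 1 \<longrightarrow>
        f (u *\<^sub>R x + v *\<^sub>R y) < u * f x + v * f y)"

definition locally_lipschitz_on :: "'a::metric_space set \<Rightarrow> ('a \<Rightarrow> 'b::metric_space) \<Rightarrow> bool" where
  "locally_lipschitz_on S f \<longleftrightarrow> (\<forall>p\<in>S. \<exists>e>0. \<exists>L. L-lipschitz_on (cball p e \<inter> S) f)"

definition abs_continuous_on :: "real set \<Rightarrow> (real \<Rightarrow> 'a::real_normed_vector) \<Rightarrow> bool" where
  "abs_continuous_on I y \<longleftrightarrow>
     (\<forall>\<epsilon>>0. \<exists>\<delta>>0. \<forall>(m::nat) (a::nat \<Rightarrow> real) (b::nat \<Rightarrow> real).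
        (\<forall>k<m. a k \<le> b k \<and> {a k..b k} \<subseteq> I) \<longrightarrow>
        disjoint_family_on (\<lambda>k. {a k<..<b k}) {..<m} \<longrightarrow>
        (\<Sum>k<m. b k - a k) < \<delta> \<longrightarrow>
        (\<Sum>k<m. norm (y (b k) - y (a k))) < \<epsilon>)"

text \<open>Curves are total functions; only their values on the interval from \<open>t\<close> to \<open>T\<close> matter below.\<close>

definition AC_curves :: "real \<Rightarrow> 'a::real_normed_vector \<Rightarrow> real \<Rightarrow> (real \<Rightarrow> 'a) set" where
  "AC_curves T x t = {y. abs_continuous_on {t..T} y \<and> y t = x}"

text \<open>The Lebesgue integral with values in the extended reals. The Bochner integral of the library
  is 0 for non-integrable functions, whereas a running cost that is bounded below but not integrable
  has to count as \<open>\<infinity>\<close>. The difference \<open>\<infinity> - \<infinity>\<close> does not occur for integrands bounded below on a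
  set of finite measure.\<close>

definition ext_integral :: "'b measure \<Rightarrow> ('b \<Rightarrow> real) \<Rightarrow> ereal" where
  "ext_integral M f =
     enn2ereal (\<integral>\<^sup>+ s. ennreal (f s) \<partial>M) - enn2ereal (\<integral>\<^sup>+ s. ennreal (- f s) \<partial>M)"

text \<open>An absolutely continuous \<open>y\<close> is differentiable almost everywhere; the arbitrary value of
  \<open>vector_derivative\<close> elsewhere is harmless because the Lebesgue measure is complete.\<close>

definition cost ::
  "real \<Rightarrow> (real \<Rightarrow> real \<Rightarrow> real) \<Rightarrow> (real ^ 'n \<Rightarrow> real) \<Rightarrow> (real ^ 'n \<Rightarrow> real) \<Rightarrow>
     real \<Rightarrow> (real \<Rightarrow> real ^ 'n) \<Rightarrow> ereal" where
  "cost T d l g t y =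
     ext_integral (lebesgue_on {t..T})
       (\<lambda>s. d t s * l (vector_derivative y (at s within {t..T})))
     + ereal (d t T * g (y T))"

definition value_function ::
  "real \<Rightarrow> (real \<Rightarrow> real \<Rightarrow> real) \<Rightarrow> (real ^ 'n \<Rightarrow> real) \<Rightarrow> (real ^ 'n \<Rightarrow> real) \<Rightarrow>
     real ^ 'n \<Rightarrow> real \<Rightarrow> ereal" where
  "value_function T d l g x t = (INF y \<in> AC_curves T x t. cost T d l g t y)"

end

theory Submission
  imports Defs
begin

text \<open>Minimizers are not needed. Write \<open>K\<close> for the Lipschitz constant of \<open>g\<close>. Superlinearity gives
  \<open>l u \<ge> ((K + 1) / a) |u| - C\<close>, hence the running cost over \<open>[t, t']\<close> is at least
  \<open>(K + 1) |y t' - y t| - C (t' - t)\<close>. This makes the value finite, bounds the end point and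
  \<open>\<integral> |l (y')|\<close> along nearly optimal curves, and yields three comparisons. Translating a curve changes
  its cost by at most \<open>K |x' - x|\<close>. Prolonging a curve backwards by a constant from \<open>t'\<close> to \<open>t\<close> costs
  \<open>O(t' - t)\<close>. Restricting a curve to \<open>[t', T]\<close> and translating it back to \<open>x\<close> costs
  \<open>K |y t' - x| + O(t' - t)\<close>, where the first term is paid for by the dropped running cost.

  The lower bound on the running cost rests on the fundamental theorem of calculus for absolutely
  continuous curves. A scalar absolutely continuous function is a difference of monotone ones, whose
  Stieltjes measures are absolutely continuous and so have Radon-Nikodym densities; Lebesgue's
  differentiation theorem identifies these with the derivative.\<close>

section \<open>Absolutely continuous curves\<close>

text \<open>Fixing one pair \<open>\<delta>\<close>, \<open>\<epsilon>\<close> allows most closure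
  properties to be proved by handing the same modulus from one function to another.\<close>

definition small_variation :: "real set \<Rightarrow> (real \<Rightarrow> 'a::real_normed_vector) \<Rightarrow> real \<Rightarrow> real \<Rightarrow> bool"
  where "small_variation I y \<delta> \<epsilon> \<longleftrightarrow> (\<forall>(m::nat) (a::nat \<Rightarrow> real) (b::nat \<Rightarrow> real).
        (\<forall>k<m. a k \<le> b k \<and> {a k..b k} \<subseteq> I) \<longrightarrow>
        disjoint_family_on (\<lambda>k. {a k<..<b k}) {..<m} \<longrightarrow>
        (\<Sum>k<m. b k - a k) < \<delta> \<longrightarrow>
        (\<Sum>k<m. norm (y (b k) - y (a k))) < \<epsilon>)"

lemma abs_continuous_on_iff:
  "abs_continuous_on I y \<longleftrightarrow> (\<forall>\<epsilon>>0. \<exists>\<delta>>0. small_variation I y \<delta> \<epsilon>)"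
  unfolding abs_continuous_on_def small_variation_def ..

lemma small_variationI:
  assumes "\<And>(m::nat) a b. \<lbrakk>\<And>k. k < m \<Longrightarrow> a k \<le> b k \<and> {a k..b k} \<subseteq> I;
        disjoint_family_on (\<lambda>k. {a k<..<b k}) {..<m}; (\<Sum>k<m. b k - a k) < \<delta>\<rbrakk>
      \<Longrightarrow> (\<Sum>k<m. norm (y (b k) - y (a k))) < \<epsilon>"
  shows "small_variation I y \<delta> \<epsilon>"
  unfolding small_variation_def using assms by simp

text \<open>Enumerating \<open>J\<close> by a bijection frees the definition from initial segments
  of the naturals. Later \<open>J\<close> consists of pairs of indices or of the intervals
  themselves.\<close>

lemma small_variationD:
  fixes a b :: "'i \<Rightarrow> real"
  assumes sv: "small_variation I y \<delta> \<epsilon>"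
    and J: "finite J" "\<And>k. k \<in> J \<Longrightarrow> a k \<le> b k \<and> {a k..b k} \<subseteq> I"
    and dj: "disjoint_family_on (\<lambda>k. {a k<..<b k}) J" and s: "(\<Sum>k\<in>J. b k - a k) < \<delta>"
  shows "(\<Sum>k\<in>J. norm (y (b k) - y (a k))) < \<epsilon>"
proof -
  obtain e where e: "bij_betw e {..<card J} J"
    using ex_bij_betw_nat_finite[OF \<open>finite J\<close>] by (auto simp: atLeast0LessThan)
  have re: "(\<Sum>k<card J. f (e k)) = (\<Sum>k\<in>J. f k)" for f :: "'i \<Rightarrow> real"
    using sum.reindex_bij_betw[OF e] .
  have eJ: "e k \<in> J" if "k < card J" for k
    using e that by (auto simp: bij_betw_def)
  have "disjoint_family_on (\<lambda>k. {a (e k)<..<b (e k)}) {..<card J}"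
    unfolding disjoint_family_on_def
  proof (intro ballI impI)
    fix m n assume mn: "m \<in> {..<card J}" "n \<in> {..<card J}" "m \<noteq> n"
    then have "e m \<noteq> e n" using e by (auto simp: bij_betw_def inj_on_def)
    then show "{a (e m)<..<b (e m)} \<inter> {a (e n)<..<b (e n)} = {}"
      using dj eJ mn unfolding disjoint_family_on_def by blast
  qed
  moreover have "(\<Sum>k<card J. b (e k) - a (e k)) < \<delta>"
    using s re[of "\<lambda>k. b k - a k"] by simp
  moreover have "\<forall>k<card J. a (e k) \<le> b (e k) \<and> {a (e k)..b (e k)} \<subseteq> I"
    using J(2) eJ by blast
  ultimately have "(\<Sum>k<card J. norm (y (b (e k)) - y (a (e k)))) < \<epsilon>"
    using sv[unfolded small_variation_def, rule_format, of "card J" "\<lambda>k. a (e k)" "\<lambda>k. b (e k)"]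
    by simp
  then show ?thesis
    using re[of "\<lambda>k. norm (y (b k) - y (a k))"] by simp
qed

text \<open>Disjointness turns the sum of lengths into the measure of a union. In this way
  containment in a small set supplies the length condition of
  \<open>small_variation\<close>.\<close>

lemma sum_disjoint_interval_lengths_le:
  fixes a b :: "'i \<Rightarrow> real"
  assumes J: "finite J" and ab: "\<And>k. k \<in> J \<Longrightarrow> a k \<le> b k"
    and "disjoint_family_on (\<lambda>k. {a k<..<b k}) J"
    and U: "\<And>k. k \<in> J \<Longrightarrow> {a k<..<b k} \<subseteq> U" and "U \<in> lmeasurable"
  shows "(\<Sum>k\<in>J. b k - a k) \<le> measure lebesgue U"
proof -
  have "(\<Sum>k\<in>J. b k - a k) = (\<Sum>k\<in>J. measure lebesgue {a k<..<b k})"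
    using ab by simp
  also have "\<dots> = measure lebesgue (\<Union>k\<in>J. {a k<..<b k})"
    using assms by (intro measure_finite_Union[symmetric]) auto
  also have "\<dots> \<le> measure lebesgue U"
    using assms by (intro measure_mono_fmeasurable) auto
  finally show ?thesis .
qed

text \<open>Clamping is monotone and does not increase distances, and a nonempty clamped interval
  lies inside the original one. Disjointness and total length are thus preserved, with the same
  \<open>\<delta>\<close>. The result extends a curve to the whole line by its boundary
  values.\<close>

lemma abs_continuous_on_clamp:
  fixes c d :: real
  assumes "abs_continuous_on {c..d} y" "c \<le> d"
  shows "abs_continuous_on UNIV (\<lambda>x. y (max c (min d x)))"
proof -
  have "small_variation UNIV (\<lambda>x. y (max c (min d x))) \<delta> \<epsilon>"
    if sv: "small_variation {c..d} y \<delta> \<epsilon>" for \<delta> \<epsilon>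
  proof (rule small_variationI)
    fix m and a b :: "nat \<Rightarrow> real"
    assume ab: "\<And>k. k < m \<Longrightarrow> a k \<le> b k \<and> {a k..b k} \<subseteq> UNIV"
      and dj: "disjoint_family_on (\<lambda>k. {a k<..<b k}) {..<m}"
      and s: "(\<Sum>k<m. b k - a k) < \<delta>"
    show "(\<Sum>k<m. norm (y (max c (min d (b k))) - y (max c (min d (a k))))) < \<epsilon>"
    proof (rule small_variationD[OF sv])
      show "max c (min d (a k)) \<le> max c (min d (b k)) \<and>
          {max c (min d (a k))..max c (min d (b k))} \<subseteq> {c..d}" if "k \<in> {..<m}" for k
        using ab[of k] assms(2) that by auto
      have "{max c (min d (a k))<..<max c (min d (b k))} \<subseteq> {a k<..<b k}" for k
        by auto
      then show "disjoint_family_on (\<lambda>k. {max c (min d (a k))<..<max c (min d (b k))}) {..<m}"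
        using dj unfolding disjoint_family_on_def by blast
      have "(\<Sum>k<m. max c (min d (b k)) - max c (min d (a k))) \<le> (\<Sum>k<m. b k - a k)"
      proof (rule sum_mono)
        fix k assume "k \<in> {..<m}"
        then show "max c (min d (b k)) - max c (min d (a k)) \<le> b k - a k"
          using ab[of k] by (auto simp: max_def min_def)
      qed
      then show "(\<Sum>k<m. max c (min d (b k)) - max c (min d (a k))) < \<delta>"
        using s by linarith
    qed simp
  qed
  then show ?thesis
    using assms(1) unfolding abs_continuous_on_iff by blast
qed

lemma abs_continuous_on_subset:
  assumes "abs_continuous_on I y" "J \<subseteq> I"
  shows "abs_continuous_on J y"
proof -
  have "small_variation J y \<delta> \<epsilon>" if sv: "small_variation I y \<delta> \<epsilon>" for \<delta> \<epsilon>
    using assms(2) by (intro small_variationI small_variationD[OF sv]) auto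
  then show ?thesis
    using assms(1) unfolding abs_continuous_on_iff by blast
qed

text \<open>Serves coordinates and translates of a curve, whose increments are dominated by those of
  the curve.\<close>

lemma abs_continuous_on_norm_le:
  assumes "abs_continuous_on I y"
    and le: "\<And>u v. norm (z v - z u) \<le> norm (y v - y u)"
  shows "abs_continuous_on I z"
proof -
  have "small_variation I z \<delta> \<epsilon>" if sv: "small_variation I y \<delta> \<epsilon>" for \<delta> \<epsilon>
    by (intro small_variationI le_less_trans[OF sum_mono[OF le] small_variationD[OF sv]]) auto
  then show ?thesis
    using assms(1) unfolding abs_continuous_on_iff by blast
qed

lemma abs_continuous_on_diff:
  assumes "abs_continuous_on I y" "abs_continuous_on I z"
  shows "abs_continuous_on I (\<lambda>x. y x - z x)"
  unfolding abs_continuous_on_iff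
proof (intro allI impI)
  fix \<epsilon> :: real assume "\<epsilon> > 0"
  then have e: "\<epsilon> / 2 > 0" by simp
  obtain \<delta>1 \<delta>2 where d: "\<delta>1 > 0" "\<delta>2 > 0"
    and 1: "small_variation I y \<delta>1 (\<epsilon> / 2)" and 2: "small_variation I z \<delta>2 (\<epsilon> / 2)"
    using assms e unfolding abs_continuous_on_iff by blast
  have "small_variation I (\<lambda>x. y x - z x) (min \<delta>1 \<delta>2) \<epsilon>"
  proof (rule small_variationI)
    fix m and a b :: "nat \<Rightarrow> real"
    assume ab: "\<And>k. k < m \<Longrightarrow> a k \<le> b k \<and> {a k..b k} \<subseteq> I"
      and dj: "disjoint_family_on (\<lambda>k. {a k<..<b k}) {..<m}"
      and s: "(\<Sum>k<m. b k - a k) < min \<delta>1 \<delta>2"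
    have "norm (y (b k) - z (b k) - (y (a k) - z (a k)))
        \<le> norm (y (b k) - y (a k)) + norm (z (b k) - z (a k))" for k
      using norm_triangle_ineq4[of "y (b k) - y (a k)" "z (b k) - z (a k)"]
      by (simp add: algebra_simps)
    then have "(\<Sum>k<m. norm (y (b k) - z (b k) - (y (a k) - z (a k))))
        \<le> (\<Sum>k<m. norm (y (b k) - y (a k)) + norm (z (b k) - z (a k)))"
      by (intro sum_mono)
    then show "(\<Sum>k<m. norm (y (b k) - z (b k) - (y (a k) - z (a k)))) < \<epsilon>"
      using small_variationD[OF 1, of "{..<m}" a b] small_variationD[OF 2, of "{..<m}" a b]
        ab dj s by (simp add: sum.distrib)
  qed
  then show "\<exists>\<delta>>0. small_variation I (\<lambda>x. y x - z x) \<delta> \<epsilon>"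
    using d by (intro exI[of _ "min \<delta>1 \<delta>2"]) simp
qed

section \<open>Disjoint families of intervals and bounded variation\<close>

text \<open>Takes the place of partitions in the definition of variation. The intervals may be
  degenerate, unordered and far apart, so clamping or truncating a family yields a family
  again.\<close>

definition interval_family :: "nat \<Rightarrow> (nat \<Rightarrow> real) \<Rightarrow> (nat \<Rightarrow> real) \<Rightarrow> bool" where
  "interval_family m a b \<longleftrightarrow>
     (\<forall>k<m. a k \<le> b k) \<and> disjoint_family_on (\<lambda>k. {a k<..<b k}) {..<m}"

lemma interval_family_clamp:
  assumes "interval_family m a b"
  shows "interval_family m (\<lambda>k. max c (min d (a k))) (\<lambda>k. max c (min d (b k)))"
proof -
  have "{max c (min d (a k))<..<max c (min d (b k))} \<subseteq> {a k<..<b k}" for k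
    by auto
  then have "disjoint_family_on (\<lambda>k. {max c (min d (a k))<..<max c (min d (b k))}) {..<m}"
    using assms unfolding interval_family_def disjoint_family_on_def by blast
  moreover have "\<forall>k<m. max c (min d (a k)) \<le> max c (min d (b k))"
    using assms unfolding interval_family_def by (auto intro!: max.mono min.mono)
  ultimately show ?thesis
    unfolding interval_family_def by blast
qed

lemma interval_family_min:
  assumes "interval_family m a b"
  shows "interval_family m (\<lambda>k. min x (a k)) (\<lambda>k. min x (b k))"
proof -
  have "{min x (a k)<..<min x (b k)} \<subseteq> {a k<..<b k}" for k
    by auto
  then have "disjoint_family_on (\<lambda>k. {min x (a k)<..<min x (b k)}) {..<m}"
    using assms unfolding interval_family_def disjoint_family_on_def by blast
  moreover have "\<forall>k<m. min x (a k) \<le> min x (b k)"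
    using assms unfolding interval_family_def by (auto intro!: min.mono)
  ultimately show ?thesis
    unfolding interval_family_def by blast
qed

text \<open>The hypothesis says that \<open>h\<close> is constant to the left of \<open>c\<close> and to the right of \<open>d\<close>.\<close>

lemma abs_continuous_bounded_variation:
  fixes h :: "real \<Rightarrow> 'a::real_normed_vector"
  assumes "abs_continuous_on UNIV h" "c < d" and const: "\<And>x. h (max c (min d x)) = h x"
  obtains C where
    "\<And>m a b. interval_family m a b \<Longrightarrow> (\<Sum>k<m. norm (h (b k) - h (a k))) \<le> C"
proof -
  obtain \<delta> where "\<delta> > 0" and sv: "small_variation UNIV h \<delta> 1"
    using assms(1) unfolding abs_continuous_on_iff by (meson zero_less_one)
  \<comment> \<open>With this \<open>N\<close>, \<open>N\<close> equal cells of
    \<open>{c..d}\<close> are each shorter than the \<open>\<delta>\<close> that belongs to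
    variation \<open>1\<close>.\<close>
  obtain N :: nat where N: "(d - c) / \<delta> < N"
    using reals_Archimedean2 by blast
  moreover have "(d - c) / \<delta> > 0"
    using \<open>c < d\<close> \<open>\<delta> > 0\<close> by simp
  ultimately have "N > 0"
    by (cases N) auto
  define p where "p i = c + real i * ((d - c) / N)" for i
  have p0: "p 0 = c" and pN: "p N = d"
    using \<open>N > 0\<close> by (auto simp: p_def)
  have step: "p (Suc i) - p i = (d - c) / N" for i
    unfolding p_def of_nat_Suc distrib_right by simp
  have pos: "(d - c) / N > 0" and less: "(d - c) / N < \<delta>"
    using N \<open>N > 0\<close> \<open>c < d\<close> \<open>\<delta> > 0\<close> by (auto simp: field_simps)
  \<comment> \<open>Clamping the family to the cells between the points \<open>p i\<close> makes each piece shorter than \<open>\<delta>\<close>.\<close>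
  define q where "q i x = max (p i) (min (p (Suc i)) x)" for i x
  \<comment> \<open>The increment of \<open>h\<close> inside cell \<open>i\<close> becomes a
    difference of truncations at neighbouring points, so the sum over the cells telescopes.\<close>
  have qh: "h (q i x) - h (p i) = h (min x (p (Suc i))) - h (min x (p i))" for i x
    using step[of i] pos by (auto simp: q_def max_def min_def)
  have telescope: "h (b) - h (a) = (\<Sum>i<N. h (q i b) - h (q i a))" for a b
  proof -
    have min_c: "h (min x c) = h c" for x
      using const[of "min x c"] \<open>c < d\<close> by (simp add: min_def max_def split: if_splits)
    have min_d: "h (min x d) - h c = h x - h c" for x
      using const[of x] const[of "min x d"] \<open>c < d\<close> by (simp add: min_def max_def split: if_splits)
    have *: "(\<Sum>i<N. h (q i x) - h (p i)) = h x - h c" for x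
      unfolding qh using sum_lessThan_telescope[of "\<lambda>i. h (min x (p i))" N]
      by (simp add: p0 pN min_c min_d)
    have "(\<Sum>i<N. h (q i b) - h (q i a)) = (\<Sum>i<N. (h (q i b) - h (p i)) - (h (q i a) - h (p i)))"
      by simp
    also have "\<dots> = (h b - h c) - (h a - h c)"
      by (subst sum_subtractf) (simp only: *)
    finally show ?thesis by simp
  qed
  show thesis
  proof
    fix m a b assume fam: "interval_family m a b"
    have "(\<Sum>k<m. norm (h (b k) - h (a k))) \<le> (\<Sum>k<m. \<Sum>i<N. norm (h (q i (b k)) - h (q i (a k))))"
      by (intro sum_mono) (subst telescope, rule norm_sum)
    also have "\<dots> = (\<Sum>i<N. \<Sum>k<m. norm (h (q i (b k)) - h (q i (a k))))"
      by (rule sum.swap)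
    \<comment> \<open>Within one cell the clamped intervals have total length below
      \<open>\<delta>\<close>, so each cell contributes at most \<open>1\<close> and the variation
      is at most \<open>N\<close>.\<close>
    also have "\<dots> \<le> (\<Sum>i<N. 1)"
    proof (intro sum_mono less_imp_le small_variationD[OF sv])
      fix i
      have q: "interval_family m (\<lambda>k. q i (a k)) (\<lambda>k. q i (b k))"
        unfolding q_def by (rule interval_family_clamp[OF fam])
      then show "disjoint_family_on (\<lambda>k. {q i (a k)<..<q i (b k)}) {..<m}"
        and "\<And>k. k \<in> {..<m} \<Longrightarrow> q i (a k) \<le> q i (b k) \<and> {q i (a k)..q i (b k)} \<subseteq> UNIV"
        by (auto simp: interval_family_def)
      have "(\<Sum>k<m. q i (b k) - q i (a k)) \<le> measure lebesgue {p i..p (Suc i)}"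
        using q step[of i] pos
        by (intro sum_disjoint_interval_lengths_le) (auto simp: interval_family_def, auto simp: q_def)
      also have "\<dots> < \<delta>"
        using step[of i] pos less by simp
      finally show "(\<Sum>k<m. q i (b k) - q i (a k)) < \<delta>" .
    qed simp
    finally show "(\<Sum>k<m. norm (h (b k) - h (a k))) \<le> real N"
      by simp
  qed
qed

section \<open>Positive variation and the Jordan decomposition\<close>

text \<open>This is the positive variation of \<open>h\<close> on the half-line up to
  \<open>x\<close>, since \<open>min x\<close> cuts all intervals off at \<open>x\<close>. The
  summands keep their sign: a family may omit the intervals on which \<open>h\<close> decreases, so
  no positive parts are required.\<close>

definition pos_variation :: "(real \<Rightarrow> real) \<Rightarrow> real \<Rightarrow> real" where
  "pos_variation h x =
     Sup {\<Sum>k<m. h (min x (b k)) - h (min x (a k)) |m a b. interval_family m a b}"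

text \<open>The empty family, with \<open>m = 0\<close>, makes the set under the supremum
  nonempty.\<close>

lemma pos_variation_least:
  assumes "\<And>m a b. interval_family m a b \<Longrightarrow> (\<Sum>k<m. h (min x (b k)) - h (min x (a k))) \<le> B"
  shows "pos_variation h x \<le> B"
proof -
  have "interval_family 0 a b" for a b
    by (simp add: interval_family_def disjoint_family_on_def)
  then show ?thesis
    unfolding pos_variation_def using assms by (intro cSup_least) blast+
qed

context
  fixes h :: "real \<Rightarrow> real" and C :: real
  assumes bv: "\<And>m a b. interval_family m a b \<Longrightarrow> (\<Sum>k<m. \<bar>h (b k) - h (a k)\<bar>) \<le> C"
begin

lemma bdd_above_pos_variation:
  "bdd_above {\<Sum>k<m. h (min x (b k)) - h (min x (a k)) |m a b. interval_family m a b}"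
proof (rule bdd_aboveI[where M = C], safe)
  fix m a b assume fam: "interval_family m a b"
  have "(\<Sum>k<m. h (min x (b k)) - h (min x (a k))) \<le> (\<Sum>k<m. \<bar>h (min x (b k)) - h (min x (a k))\<bar>)"
    by (intro sum_mono) simp
  also have "\<dots> \<le> C"
    by (rule bv[OF interval_family_min[OF fam]])
  finally show "(\<Sum>k<m. h (min x (b k)) - h (min x (a k))) \<le> C" .
qed

lemma pos_variation_upper:
  "interval_family m a b \<Longrightarrow> (\<Sum>k<m. h (min x (b k)) - h (min x (a k))) \<le> pos_variation h x"
  unfolding pos_variation_def by (rule cSup_upper[OF _ bdd_above_pos_variation]) blast

lemma pos_variation_approx:
  assumes "e > 0"
  shows "\<exists>m a b. interval_family m a b \<and>
    pos_variation h x - e < (\<Sum>k<m. h (min x (b k)) - h (min x (a k)))"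
proof (rule ccontr)
  assume "\<not> ?thesis"
  then have "pos_variation h x \<le> pos_variation h x - e"
    by (intro pos_variation_least) force
  with assms show False by simp
qed

text \<open>A family truncated at \<open>x\<close> competes at \<open>x'\<close> with the same sum,
  since truncating it again at \<open>x'\<close> changes nothing.\<close>

lemma mono_pos_variation: "mono (pos_variation h)"
proof (rule monoI, rule pos_variation_least)
  fix x x' :: real and m a b
  assume "x \<le> x'" and fam: "interval_family m a b"
  then show "(\<Sum>k<m. h (min x (b k)) - h (min x (a k))) \<le> pos_variation h x'"
    using pos_variation_upper[OF interval_family_min[OF fam, of x], of x']
    by (simp add: min.absorb2 min.coboundedI1)
qed

text \<open>Truncate a family at \<open>x\<close> and append the interval from \<open>x\<close> to
  \<open>x'\<close> as member \<open>m\<close>. The enlarged family competes at \<open>x'\<close>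
  and gains exactly \<open>h x' - h x\<close>. This is what makes \<open>pos_variation h - h\<close>
  monotone.\<close>

lemma pos_variation_increment:
  assumes "x \<le> x'"
  shows "h x' - h x \<le> pos_variation h x' - pos_variation h x"
proof -
  have "pos_variation h x \<le> pos_variation h x' - (h x' - h x)"
  proof (rule pos_variation_least)
    fix m a b assume fam: "interval_family m a b"
    define a' where "a' k = (if k < m then min x (a k) else x)" for k
    define b' where "b' k = (if k < m then min x (b k) else x')" for k
    have "interval_family (Suc m) a' b'"
      unfolding interval_family_def
    proof (intro conjI allI impI)
      fix k show "a' k \<le> b' k" if "k < Suc m"
        using fam assms by (auto simp: a'_def b'_def interval_family_def intro!: min.mono)
      show "disjoint_family_on (\<lambda>k. {a' k<..<b' k}) {..<Suc m}"
        unfolding disjoint_family_on_def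
      proof (intro ballI impI)
        fix i j assume ij: "i \<in> {..<Suc m}" "j \<in> {..<Suc m}" "i \<noteq> j"
        have sub: "{a' k<..<b' k} \<subseteq> {a k<..<b k} \<inter> {..<x}" if "k < m" for k
          using that by (auto simp: a'_def b'_def)
        have last: "{a' k<..<b' k} \<subseteq> {x<..}" if "\<not> k < m" for k
          using that by (auto simp: a'_def b'_def)
        show "{a' i<..<b' i} \<inter> {a' j<..<b' j} = {}"
        proof (cases "i < m \<and> j < m")
          case True
          then show ?thesis
            using sub[of i] sub[of j] fam ij
            unfolding interval_family_def disjoint_family_on_def by blast
        next
          case False
          with ij consider "i < m" "\<not> j < m" | "\<not> i < m" "j < m"
            by (auto simp: less_Suc_eq)
          moreover have "{..<x} \<inter> {x<..} = {}" by auto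
          ultimately show ?thesis
            using sub[of i] sub[of j] last[of i] last[of j] by cases blast+
        qed
      qed
    qed
    from pos_variation_upper[OF this, of x']
    show "(\<Sum>k<m. h (min x (b k)) - h (min x (a k))) \<le> pos_variation h x' - (h x' - h x)"
      using assms by (simp add: a'_def b'_def min.absorb2 min.coboundedI1)
  qed
  then show ?thesis by simp
qed

text \<open>For each \<open>j\<close> choose a nearly optimal family for \<open>B j\<close> and
  split it at \<open>A j\<close>. The left part is bounded by the positive variation at
  \<open>A j\<close>. The right parts, taken over all \<open>j\<close>, form one disjoint family of
  total length below \<open>\<delta>\<close>, to which the modulus of \<open>h\<close>
  applies.\<close>

lemma small_variation_pos_variation:
  assumes sv: "small_variation UNIV h \<delta> (\<epsilon> / 2)" and "\<epsilon> > 0"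
  shows "small_variation UNIV (pos_variation h) \<delta> \<epsilon>"
proof (rule small_variationI)
  fix m and A B :: "nat \<Rightarrow> real"
  assume AB: "\<And>k. k < m \<Longrightarrow> A k \<le> B k \<and> {A k..B k} \<subseteq> UNIV"
    and dj: "disjoint_family_on (\<lambda>k. {A k<..<B k}) {..<m}"
    and s: "(\<Sum>k<m. B k - A k) < \<delta>"
  \<comment> \<open>One error \<open>\<eta>\<close> is made for each of the \<open>m\<close>
    intervals. Together they use at most half of \<open>\<epsilon>\<close>, and the \<open>1\<close>
    added to \<open>m\<close> avoids division by zero.\<close>
  define \<eta> where "\<eta> = \<epsilon> / (2 * (real m + 1))"
  have "\<eta> > 0" using \<open>\<epsilon> > 0\<close> by (simp add: \<eta>_def)
  then have "\<forall>j. \<exists>n a b. interval_family n a b \<and>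
      pos_variation h (B j) - \<eta> < (\<Sum>k<n. h (min (B j) (b k)) - h (min (B j) (a k)))"
    using pos_variation_approx by blast
  then obtain n a b where fam: "\<And>j. interval_family (n j) (a j) (b j)"
    and near: "\<And>j. pos_variation h (B j) - \<eta> <
      (\<Sum>k<n j. h (min (B j) (b j k)) - h (min (B j) (a j k)))"
    by metis
  define q where "q j x = max (A j) (min (B j) x)" for j x
  have split: "h (min (B j) x) = h (min (A j) x) + h (q j x) - h (A j)" if "j < m" for j x
    using AB[OF that] by (auto simp: q_def max_def min_def)
  have qfam: "interval_family (n j) (\<lambda>k. q j (a j k)) (\<lambda>k. q j (b j k))" for j
    unfolding q_def by (rule interval_family_clamp[OF fam])
  have inc: "pos_variation h (B j) - pos_variation h (A j)
      \<le> \<eta> + (\<Sum>k<n j. norm (h (q j (b j k)) - h (q j (a j k))))" if "j < m" for j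
  proof -
    have "pos_variation h (B j) - \<eta> < (\<Sum>k<n j. h (min (B j) (b j k)) - h (min (B j) (a j k)))"
      by (rule near)
    also have "\<dots> = (\<Sum>k<n j. h (min (A j) (b j k)) - h (min (A j) (a j k)))
        + (\<Sum>k<n j. h (q j (b j k)) - h (q j (a j k)))"
      unfolding sum.distrib[symmetric] by (intro sum.cong) (auto simp: split[OF that])
    also have "\<dots> \<le> pos_variation h (A j) + (\<Sum>k<n j. norm (h (q j (b j k)) - h (q j (a j k))))"
      by (intro add_mono pos_variation_upper fam sum_mono) simp
    finally show ?thesis by simp
  qed
  have "(\<Sum>j<m. norm (pos_variation h (B j) - pos_variation h (A j)))
      = (\<Sum>j<m. pos_variation h (B j) - pos_variation h (A j))"
    using AB by (intro sum.cong refl) (simp add: monoD[OF mono_pos_variation])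
  also have "\<dots> \<le> (\<Sum>j<m. \<eta> + (\<Sum>k<n j. norm (h (q j (b j k)) - h (q j (a j k)))))"
    by (intro sum_mono inc) simp
  \<comment> \<open>The double sum is rewritten over pairs so that the modulus of \<open>h\<close>
    can be applied once, to all clamped intervals at the same time.\<close>
  also have "\<dots> = real m * \<eta> + (\<Sum>p\<in>Sigma {..<m} (\<lambda>j. {..<n j}).
      norm (h (q (fst p) (b (fst p) (snd p))) - h (q (fst p) (a (fst p) (snd p)))))"
    by (simp add: sum.distrib sum.Sigma split_beta)
  also have "\<dots> < \<epsilon> / 2 + \<epsilon> / 2"
  proof (intro add_le_less_mono small_variationD[OF sv])
    show "real m * \<eta> \<le> \<epsilon> / 2"
      using \<open>\<epsilon> > 0\<close> by (simp add: \<eta>_def field_simps)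
    let ?J = "Sigma {..<m} (\<lambda>j. {..<n j})"
    let ?a = "\<lambda>p. q (fst p) (a (fst p) (snd p))" and ?b = "\<lambda>p. q (fst p) (b (fst p) (snd p))"
    show "finite ?J" by simp
    show "?a p \<le> ?b p \<and> {?a p..?b p} \<subseteq> UNIV" if "p \<in> ?J" for p
      using qfam that by (auto simp: interval_family_def)
    have sub: "{?a p<..<?b p} \<subseteq> {A (fst p)<..<B (fst p)}" if "p \<in> ?J" for p
      using AB[of "fst p"] that by (auto simp: q_def)
    show "disjoint_family_on (\<lambda>p. {?a p<..<?b p}) ?J"
      unfolding disjoint_family_on_def
    proof (intro ballI impI)
      fix p r assume pr: "p \<in> ?J" "r \<in> ?J" "p \<noteq> r"
      show "{?a p<..<?b p} \<inter> {?a r<..<?b r} = {}"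
      proof (cases "fst p = fst r")
        case True
        then have "snd p \<noteq> snd r" using pr by (simp add: prod_eq_iff)
        then show ?thesis
          using True pr qfam[of "fst p"]
          unfolding interval_family_def disjoint_family_on_def by auto
      next
        case False
        then have "{A (fst p)<..<B (fst p)} \<inter> {A (fst r)<..<B (fst r)} = {}"
          using dj pr unfolding disjoint_family_on_def by auto
        then show ?thesis
          using sub[OF pr(1)] sub[OF pr(2)] by blast
      qed
    qed
    have "(\<Sum>p\<in>?J. ?b p - ?a p) = (\<Sum>j<m. \<Sum>k<n j. q j (b j k) - q j (a j k))"
      by (simp add: sum.Sigma split_beta)
    also have "\<dots> \<le> (\<Sum>j<m. B j - A j)"
    proof (rule sum_mono)
      fix j assume "j \<in> {..<m}"
      then have "A j \<le> B j" using AB by simp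
      then have "(\<Sum>k<n j. q j (b j k) - q j (a j k)) \<le> measure lebesgue {A j..B j}"
        using qfam[of j]
        by (intro sum_disjoint_interval_lengths_le) (auto simp: interval_family_def, auto simp: q_def)
      then show "(\<Sum>k<n j. q j (b j k) - q j (a j k)) \<le> B j - A j"
        using \<open>A j \<le> B j\<close> by simp
    qed
    finally show "(\<Sum>p\<in>?J. ?b p - ?a p) < \<delta>"
      using s by simp
  qed
  finally show "(\<Sum>j<m. norm (pos_variation h (B j) - pos_variation h (A j))) < \<epsilon>"
    by simp
qed

end

text \<open>Take the positive variation for \<open>F\<close> and its excess over \<open>h\<close>
  for \<open>G\<close>. Both inherit absolute continuity.\<close>

lemma abs_continuous_Jordan_decomposition:
  fixes h :: "real \<Rightarrow> real"
  assumes ac: "abs_continuous_on UNIV h" and "c < d" and "\<And>x. h (max c (min d x)) = h x"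
  obtains F G where "mono F" "mono G" "abs_continuous_on UNIV F" "abs_continuous_on UNIV G"
    "\<And>x. h x = F x - G x"
proof -
  obtain C where bv: "\<And>m a b. interval_family m a b \<Longrightarrow> (\<Sum>k<m. \<bar>h (b k) - h (a k)\<bar>) \<le> C"
    using abs_continuous_bounded_variation[OF assms] by auto
  have acF: "abs_continuous_on UNIV (pos_variation h)"
    unfolding abs_continuous_on_iff
    using ac small_variation_pos_variation[OF bv] unfolding abs_continuous_on_iff
    by (meson half_gt_zero)
  show thesis
  proof
    show "mono (pos_variation h)"
      by (rule mono_pos_variation[OF bv])
    show "mono (\<lambda>x. pos_variation h x - h x)"
      using pos_variation_increment[OF bv] by (intro monoI) (simp add: algebra_simps)
    show "abs_continuous_on UNIV (\<lambda>x. pos_variation h x - h x)"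
      by (rule abs_continuous_on_diff[OF acF ac])
  qed (use acF in auto)
qed

section \<open>The fundamental theorem of calculus\<close>

lemma abs_continuous_on_UNIV_imp_continuous_on:
  fixes F :: "real \<Rightarrow> 'a::real_normed_vector"
  assumes "abs_continuous_on UNIV F"
  shows "continuous_on UNIV F"
  unfolding continuous_on_iff
proof (intro ballI allI impI)
  fix x \<epsilon> :: real assume "\<epsilon> > 0"
  then obtain \<delta> where "\<delta> > 0" and sv: "small_variation UNIV F \<delta> \<epsilon>"
    using assms unfolding abs_continuous_on_iff by blast
  have near: "norm (F v - F u) < \<epsilon>" if "u \<le> v" "v - u < \<delta>" for u v
    using small_variationD[OF sv, of "{0::nat}" "\<lambda>_. u" "\<lambda>_. v"] that
    by (simp add: disjoint_family_on_def)
  have "dist (F x') (F x) < \<epsilon>" if "dist x' x < \<delta>" for x'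
    using near[of x x'] near[of x' x] that
    by (cases "x \<le> x'") (auto simp: dist_norm norm_minus_commute)
  with \<open>\<delta> > 0\<close> show "\<exists>d>0. \<forall>x'\<in>UNIV. dist x' x < d \<longrightarrow> dist (F x') (F x) < \<epsilon>"
    by blast
qed

section \<open>Stieltjes measures and null sets\<close>

text \<open>A null set has an open neighbourhood \<open>U\<close> of measure below
  \<open>\<delta>\<close>. It is covered by countably many nonoverlapping closed intervals inside
  \<open>U\<close>. Any finitely many of them have Stieltjes measure equal to a sum of increments of
  \<open>F\<close>, which is below \<open>\<epsilon>\<close>, and continuity from below passes to
  the whole cover.\<close>

lemma emeasure_interval_measure_small:
  fixes F :: "real \<Rightarrow> real"
  assumes "mono F" and cont: "continuous_on UNIV F" and sv: "small_variation UNIV F \<delta> \<epsilon>"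
    and "\<delta> > 0" and S: "S \<in> null_sets lborel" "S \<subseteq> {c..d}" "c < d"
  shows "emeasure (interval_measure F) S \<le> ennreal \<epsilon>"
proof -
  let ?\<nu> = "interval_measure F"
  have SL: "S \<in> sets lebesgue" "emeasure lebesgue S = 0"
    using null_sets_completionI[OF S(1)] by auto
  obtain U where U: "open U" "S \<subseteq> U" "U - S \<in> lmeasurable" "emeasure lebesgue (U - S) < ennreal \<delta>"
    using sets_lebesgue_outer_open[OF SL(1) \<open>\<delta> > 0\<close>] by blast
  have "emeasure lebesgue U = emeasure lebesgue (S \<union> (U - S))"
    using U(2) by (simp add: Un_absorb1 Un_commute)
  also have "\<dots> \<le> emeasure lebesgue S + emeasure lebesgue (U - S)"
    using SL U(3) by (intro emeasure_subadditive) (auto dest: fmeasurableD)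
  finally have eU: "emeasure lebesgue U < ennreal \<delta>"
    using SL U(4) by simp
  have Um: "U \<in> lmeasurable"
    using eU U(1) by (intro fmeasurableI) (auto intro: less_trans)
  then have mU: "measure lebesgue U < \<delta>"
    using eU \<open>\<delta> > 0\<close> by (simp add: emeasure_eq_measure2 ennreal_less_iff)
  \<comment> \<open>Every covering interval meets \<open>S\<close> in a point whose gauge set
    contains the interval. On \<open>S\<close> this set is \<open>U\<close>, so all covering
    intervals lie in \<open>U\<close>; the value \<open>UNIV\<close> off \<open>U\<close> completes
    the gauge.\<close>
  define g where "g x = (if x \<in> U then U else UNIV)" for x :: real
  have g: "gauge g"
    using U(1) by (auto simp: gauge_def g_def)
  have cd: "S \<subseteq> cbox c d" "box c d \<noteq> {}"
    using S by auto
  have "\<exists>\<D>. countable \<D> \<and> (\<forall>K\<in>\<D>. interior K \<noteq> {} \<and> (\<exists>u v. K = cbox u v)) \<and>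
      pairwise (\<lambda>A B. interior A \<inter> interior B = {}) \<D> \<and>
      (\<forall>K\<in>\<D>. \<exists>x \<in> S \<inter> K. K \<subseteq> g x) \<and> S \<subseteq> \<Union>\<D>"
  proof (rule covering_lemma[OF cd g])
    fix \<D> :: "real set set"
    assume "countable \<D>" "\<And>K. K \<in> \<D> \<Longrightarrow> interior K \<noteq> {} \<and> (\<exists>u v. K = cbox u v)"
      "pairwise (\<lambda>A B. interior A \<inter> interior B = {}) \<D>"
      "\<And>K. K \<in> \<D> \<Longrightarrow> \<exists>x \<in> S \<inter> K. K \<subseteq> g x" "S \<subseteq> \<Union>\<D>"
    then show ?thesis
      by (intro exI[of _ \<D>] conjI ballI) simp_all
  qed
  then obtain \<D> where cnt: "countable \<D>"
    and box: "\<And>K. K \<in> \<D> \<Longrightarrow> interior K \<noteq> {} \<and> (\<exists>u v. K = cbox u v)"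
    and pw: "pairwise (\<lambda>A B. interior A \<inter> interior B = {}) \<D>"
    and fine: "\<And>K. K \<in> \<D> \<Longrightarrow> \<exists>x \<in> S \<inter> K. K \<subseteq> g x" and cov: "S \<subseteq> \<Union>\<D>"
    by (elim exE conjE) (rule that; simp)
  have KU: "K \<subseteq> U" if KD: "K \<in> \<D>" for K
  proof -
    obtain x where "x \<in> S" "K \<subseteq> g x"
      using fine[OF KD] by auto
    moreover have "x \<in> U"
      using \<open>x \<in> S\<close> U(2) by blast
    ultimately show ?thesis
      by (simp add: g_def)
  qed
  \<comment> \<open>The endpoints become functions of the interval, so the intervals can index their
    own family in \<open>small_variationD\<close>.\<close>
  have K: "Inf K < Sup K \<and> K = {Inf K..Sup K}" if KD: "K \<in> \<D>" for K
  proof -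
    obtain u v where uv: "K = {u..v}" "interior K \<noteq> {}"
      using box[OF KD] by auto
    then have "u < v" by (auto simp: not_less)
    then show ?thesis using uv by simp
  qed
  have Klt: "Inf K < Sup K" and Keq: "K = {Inf K..Sup K}" if "K \<in> \<D>" for K
    using K[OF that] by blast+
  have finite: "(\<Sum>K\<in>J. emeasure ?\<nu> K) \<le> ennreal \<epsilon>" if J: "finite J" "J \<subseteq> \<D>" for J
  proof -
    have "emeasure ?\<nu> K = ennreal (norm (F (Sup K) - F (Inf K)))" if "K \<in> J" for K
    proof -
      have "K \<in> \<D>" using J that by blast
      have "emeasure ?\<nu> K = emeasure ?\<nu> {Inf K..Sup K}"
        by (rule arg_cong[OF Keq[OF \<open>K \<in> \<D>\<close>]])
      also have "\<dots> = ennreal (F (Sup K) - F (Inf K))"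
        using Klt[OF \<open>K \<in> \<D>\<close>] \<open>mono F\<close> cont
        by (intro emeasure_interval_measure_Icc) (auto dest: monoD)
      also have "F (Sup K) - F (Inf K) = norm (F (Sup K) - F (Inf K))"
        using Klt[OF \<open>K \<in> \<D>\<close>] monoD[OF \<open>mono F\<close>, of "Inf K" "Sup K"] by simp
      finally show ?thesis .
    qed
    then have "(\<Sum>K\<in>J. emeasure ?\<nu> K) = ennreal (\<Sum>K\<in>J. norm (F (Sup K) - F (Inf K)))"
      by (simp add: sum_ennreal)
    also have "\<dots> \<le> ennreal \<epsilon>"
    proof (intro ennreal_leI less_imp_le small_variationD[OF sv])
      have int: "interior K = {Inf K<..<Sup K}" if "K \<in> J" for K
        using arg_cong[OF Keq, of K interior] J that
        by (simp only: interior_atLeastAtMost_real) blast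
      show dj: "disjoint_family_on (\<lambda>K. {Inf K<..<Sup K}) J"
        unfolding disjoint_family_on_def
      proof (intro ballI impI)
        fix K L assume "K \<in> J" "L \<in> J" "K \<noteq> L"
        then show "{Inf K<..<Sup K} \<inter> {Inf L<..<Sup L} = {}"
          using pairwiseD[OF pw, of K L] int[of K] int[of L] J(2) by auto
      qed
      have "(\<Sum>K\<in>J. Sup K - Inf K) \<le> measure lebesgue U"
      proof (rule sum_disjoint_interval_lengths_le[OF \<open>finite J\<close> _ dj _ Um])
        show "Inf K \<le> Sup K" if "K \<in> J" for K
          using Klt[of K] J that by (auto intro: less_imp_le)
        show "{Inf K<..<Sup K} \<subseteq> U" if "K \<in> J" for K
          using KU[of K] int[OF that] interior_subset[of K] J that by auto
      qed
      with mU show "(\<Sum>K\<in>J. Sup K - Inf K) < \<delta>" by simp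
      show "Inf K \<le> Sup K \<and> {Inf K..Sup K} \<subseteq> UNIV" if "K \<in> J" for K
        using Klt[of K] J that by (auto intro: less_imp_le)
    qed (use J in auto)
    finally show ?thesis .
  qed
  have Kb: "K \<in> sets ?\<nu>" if "K \<in> \<D>" for K
    using box[OF that] by auto
  have "emeasure ?\<nu> S \<le> emeasure ?\<nu> (\<Union>\<D>)"
    using cov cnt Kb by (intro emeasure_mono) (auto intro!: sets.countable_Union)
  also have "\<dots> \<le> ennreal \<epsilon>"
  proof (cases "\<D> = {}")
    case False
    \<comment> \<open>If \<open>\<D>\<close> is finite this enumeration repeats members. Working
      with images of initial segments as sets counts each interval once.\<close>
    define e where "e = from_nat_into \<D>"
    have e: "e ` {..<n} \<subseteq> \<D>" for n
      unfolding e_def using from_nat_into[OF False] by auto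
    have "\<Union>\<D> = (\<Union>n. \<Union>K\<in>e ` {..<n}. K)"
    proof -
      have "\<D> = range e"
        unfolding e_def using range_from_nat_into[OF False cnt] by simp
      then show ?thesis by (auto intro: lessI)
    qed
    also have "emeasure ?\<nu> \<dots> = (SUP n. emeasure ?\<nu> (\<Union>K\<in>e ` {..<n}. K))"
    proof (intro SUP_emeasure_incseq[symmetric])
      have "(\<Union>K\<in>e ` {..<n}. K) \<in> sets ?\<nu>" for n
        using e[of n] Kb by (intro sets.finite_UN) blast+
      then show "range (\<lambda>n. \<Union>K\<in>e ` {..<n}. K) \<subseteq> sets ?\<nu>" by blast
      show "incseq (\<lambda>n. \<Union>K\<in>e ` {..<n}. K)"
        unfolding incseq_def by (intro allI impI UN_mono image_mono) auto
    qed
    also have "\<dots> \<le> ennreal \<epsilon>"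
    proof (rule SUP_least)
      fix n
      have "emeasure ?\<nu> (\<Union>K\<in>e ` {..<n}. K) \<le> (\<Sum>K\<in>e ` {..<n}. emeasure ?\<nu> K)"
        using e Kb by (intro emeasure_subadditive_finite) auto
      also have "\<dots> \<le> ennreal \<epsilon>"
        using finite e by blast
      finally show "emeasure ?\<nu> (\<Union>K\<in>e ` {..<n}. K) \<le> ennreal \<epsilon>" .
    qed
    finally show ?thesis .
  qed simp
  finally show ?thesis .
qed

text \<open>The estimate for small sets is stated within a bounded interval, so a null set is first
  cut into countably many bounded pieces.\<close>

lemma absolutely_continuous_interval_measure:
  fixes F :: "real \<Rightarrow> real"
  assumes "mono F" "abs_continuous_on UNIV F"
  shows "absolutely_continuous lborel (interval_measure F)"
  unfolding absolutely_continuous_def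
proof
  fix A :: "real set" assume A: "A \<in> null_sets lborel"
  have "A \<inter> {- real (Suc n)..real (Suc n)} \<in> null_sets (interval_measure F)" for n
  proof (rule null_setsI)
    let ?S = "A \<inter> {- real (Suc n)..real (Suc n)}"
    have S: "?S \<in> null_sets lborel"
      using A by (rule null_set_Int2) simp
    show "?S \<in> sets (interval_measure F)"
      using S by auto
    have "emeasure (interval_measure F) ?S \<le> 0 + ennreal \<epsilon>" if "\<epsilon> > 0" for \<epsilon>
    proof -
      obtain \<delta> where "\<delta> > 0" "small_variation UNIV F \<delta> \<epsilon>"
        using assms(2) \<open>\<epsilon> > 0\<close> unfolding abs_continuous_on_iff by blast
      then show ?thesis
        using emeasure_interval_measure_small[OF assms(1)
            abs_continuous_on_UNIV_imp_continuous_on[OF assms(2)] _ _ S, of \<delta> \<epsilon> "- real (Suc n)" "real (Suc n)"] by simp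
    qed
    then show "emeasure (interval_measure F) ?S = 0"
      by (metis ennreal_le_epsilon le_zero_eq)
  qed
  then have "(\<Union>n. A \<inter> {- real (Suc n)..real (Suc n)}) \<in> null_sets (interval_measure F)"
    by blast
  moreover have "(\<Union>n. A \<inter> {- real (Suc n)..real (Suc n)}) = A"
  proof -
    have "\<exists>n. \<bar>x\<bar> \<le> real (Suc n)" for x :: real
      by (metis real_arch_simple le_SucI of_nat_mono order_trans le_refl)
    then show ?thesis by (auto simp: abs_le_iff) (smt (verit))+
  qed
  ultimately show "A \<in> null_sets (interval_measure F)" by simp
qed

section \<open>Densities and differentiation of indefinite integrals\<close>

text \<open>The Radon-Nikodym density of the Stieltjes measure is made real-valued; its integral
  over \<open>{u..v}\<close> is the Stieltjes measure of that interval.\<close>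

lemma mono_abs_continuous_density:
  fixes F :: "real \<Rightarrow> real"
  assumes "mono F" and ac: "abs_continuous_on UNIV F"
  obtains f where "\<And>x. f x \<ge> 0" "\<And>u v. u \<le> v \<Longrightarrow> (f has_integral F v - F u) {u..v}"
proof -
  obtain D where D: "D \<in> borel_measurable lborel" "density lborel D = interval_measure F"
    using sigma_finite_measure.Radon_Nikodym[OF sigma_finite_lborel
        absolutely_continuous_interval_measure[OF assms]] by (auto simp: sets_interval_measure)
  have [measurable]: "D \<in> borel_measurable borel"
    using D(1) by simp
  define f where "f x = enn2real (D x)" for x
  show thesis
  proof
    show "f x \<ge> 0" for x by (simp add: f_def)
    fix u v :: real assume "u \<le> v"
    have "F u \<le> F v" using \<open>mono F\<close> \<open>u \<le> v\<close> by (rule monoD)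
    have *: "(\<integral>\<^sup>+x. D x * indicator {u..v} x \<partial>lborel) = ennreal (F v - F u)"
    proof -
      have "(\<integral>\<^sup>+x. D x * indicator {u..v} x \<partial>lborel) = emeasure (density lborel D) {u..v}"
        by (subst emeasure_density) auto
      also have "\<dots> = ennreal (F v - F u)"
        unfolding D(2) using \<open>u \<le> v\<close> \<open>mono F\<close> abs_continuous_on_UNIV_imp_continuous_on[OF ac]
        by (intro emeasure_interval_measure_Icc) (auto dest: monoD)
      finally show ?thesis .
    qed
    \<comment> \<open>A finite integral forces the density to be finite almost everywhere on
      \<open>{u..v}\<close>, so \<open>enn2real\<close> leaves the integral unchanged.\<close>
    have "AE x in lborel. D x * indicator {u..v} x \<noteq> \<infinity>"
      using * by (intro nn_integral_PInf_AE) auto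
    then have "AE x in lborel. ennreal (f x * indicator {u..v} x) = D x * indicator {u..v} x"
      by eventually_elim (auto simp: f_def indicator_def less_top)
    then have "(\<integral>\<^sup>+x. ennreal (f x * indicator {u..v} x) \<partial>lborel) = ennreal (F v - F u)"
      using nn_integral_cong_AE * by metis
    then have "((\<lambda>x. f x * indicator {u..v} x) has_integral F v - F u) UNIV"
      using \<open>F u \<le> F v\<close> by (intro nn_integral_has_integral) (auto simp: f_def)
    moreover have "(\<lambda>x. f x * indicator {u..v} x) = (\<lambda>x. if x \<in> {u..v} then f x else 0)"
      by (auto simp: indicator_def)
    ultimately show "(f has_integral F v - F u) {u..v}"
      by (simp only: has_integral_restrict_UNIV)
  qed
qed

text \<open>Lebesgue differentiation is applied to averages to the right of a point. Applied to
  \<open>f\<close> it gives the right derivative, and applied to the reflection of \<open>f\<close>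
  the left derivative; the exceptional set of the latter is reflected back.\<close>

lemma indefinite_integral_has_vector_derivative_ae:
  fixes Y f :: "real \<Rightarrow> 'a::euclidean_space"
  assumes int: "\<And>u v. u \<le> v \<Longrightarrow> (f has_integral Y v - Y u) {u..v}"
  obtains N where "negligible N" "\<And>x. x \<notin> N \<Longrightarrow> (Y has_vector_derivative f x) (at x)"
proof -
  have ref: "((\<lambda>x. f (- x)) has_integral Y (- u) - Y (- v)) {u..v}" if "u \<le> v" for u v
    using has_integral_reflect_real[of f "Y (- u) - Y (- v)" "- u" "- v"] int[of "- v" "- u"] that
    unfolding minus_minus by simp
  have *: "\<exists>N. negligible N \<and> (\<forall>x e. x \<notin> N \<longrightarrow> 0 < e \<longrightarrow> (\<exists>d>0. \<forall>h. 0 < h \<and> h < d \<longrightarrow>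
        norm (integral {x..x + h} k /\<^sub>R h - k x) < e))"
    if k: "\<And>u v. u \<le> v \<Longrightarrow> k integrable_on {u..v}" for k :: "real \<Rightarrow> 'a"
  proof (rule integrable_ccontinuous_explicit)
    show "k integrable_on cbox u v" for u v
      using k[of u v] by (cases "u \<le> v") auto
    fix N :: "real set"
    assume N: "negligible N" "\<And>x e. \<lbrakk>x \<notin> N; 0 < e\<rbrakk> \<Longrightarrow> \<exists>d>0. \<forall>h. 0 < h \<and> h < d \<longrightarrow>
        norm (integral (cbox x (x + h *\<^sub>R One)) k /\<^sub>R h ^ DIM(real) - k x) < e"
    have "\<exists>d>0. \<forall>h. 0 < h \<and> h < d \<longrightarrow> norm (integral {x..x + h} k /\<^sub>R h - k x) < e"
      if "x \<notin> N" "0 < e" for x e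
      using N(2)[OF that] by simp
    with N(1) show ?thesis
      by (intro exI[of _ N] conjI allI impI)
  qed
  obtain N1 where N1: "negligible N1" "\<forall>x e. x \<notin> N1 \<longrightarrow> 0 < e \<longrightarrow> (\<exists>d>0. \<forall>h. 0 < h \<and> h < d \<longrightarrow>
        norm (integral {x..x + h} f /\<^sub>R h - f x) < e)"
    using *[of f] has_integral_integrable[OF int] by blast
  obtain N2 where N2: "negligible N2" "\<forall>x e. x \<notin> N2 \<longrightarrow> 0 < e \<longrightarrow> (\<exists>d>0. \<forall>h. 0 < h \<and> h < d \<longrightarrow>
        norm (integral {x..x + h} (\<lambda>x. f (- x)) /\<^sub>R h - f (- x)) < e)"
    using *[of "\<lambda>x. f (- x)"] has_integral_integrable[OF ref] by blast
  show thesis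
  proof
    have "negligible (uminus ` N2)"
      using N2(1) by (rule negligible_differentiable_image_negligible[rotated])
        (auto intro!: derivative_intros simp: differentiable_on_def)
    then show "negligible (N1 \<union> uminus ` N2)"
      using N1(1) by simp
    fix x assume x: "x \<notin> N1 \<union> uminus ` N2"
    then have "- x \<notin> N2" by force
    show "(Y has_vector_derivative f x) (at x)"
      unfolding has_vector_derivative_def has_derivative_at_alt
    proof (intro conjI allI impI bounded_linear_scaleR_left)
      fix e :: real assume "e > 0"
      obtain d1 where "d1 > 0" and d1: "\<And>h. 0 < h \<Longrightarrow> h < d1 \<Longrightarrow>
          norm (integral {x..x + h} f /\<^sub>R h - f x) < e"
        using N1(2)[rule_format, of x e] x \<open>e > 0\<close> by auto
      obtain d2 where "d2 > 0" and d2: "\<And>h. 0 < h \<Longrightarrow> h < d2 \<Longrightarrow>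
          norm (integral {- x..- x + h} (\<lambda>x. f (- x)) /\<^sub>R h - f x) < e"
        using N2(2)[rule_format, of "- x" e] \<open>- x \<notin> N2\<close> \<open>e > 0\<close> by auto
      \<comment> \<open>Converts an estimate for averages into the estimate for increments that
        \<open>has_derivative_at_alt\<close> asks for.\<close>
      have scale: "norm (z - h *\<^sub>R w) \<le> e * h" if "norm (z /\<^sub>R h - w) < e" "h > 0" for z w :: 'a and h
      proof -
        have "z - h *\<^sub>R w = h *\<^sub>R (z /\<^sub>R h - w)"
          using that(2) by (simp add: algebra_simps)
        then show ?thesis
          using that by (simp add: mult.commute)
      qed
      have "norm (Y y - Y x - (y - x) *\<^sub>R f x) \<le> e * norm (y - x)"
        if "norm (y - x) < min d1 d2" for y
      proof (cases y x rule: linorder_cases)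
        case equal then show ?thesis by simp
      next
        case greater
        then have "integral {x..x + (y - x)} f = Y y - Y x"
          using int[of x y] by (simp add: integral_unique)
        then show ?thesis
          using scale[OF d1[of "y - x"]] greater that by simp
      next
        case less
        then have "integral {- x..- x + (x - y)} (\<lambda>x. f (- x)) = Y x - Y y"
          using ref[of "- x" "- y"] by (simp add: integral_unique)
        then have "norm (Y x - Y y - (x - y) *\<^sub>R f x) \<le> e * (x - y)"
          using scale[OF d2[of "x - y"]] less that by simp
        moreover have "Y y - Y x - (y - x) *\<^sub>R f x = - (Y x - Y y - (x - y) *\<^sub>R f x)"
          by (simp add: algebra_simps)
        ultimately show ?thesis
          using less by (metis abs_of_neg norm_minus_cancel minus_diff_eq real_norm_def diff_less_0_iff_less)
      qed
      then show "\<exists>d>0. \<forall>y. norm (y - x) < d \<longrightarrow> norm (Y y - Y x - (y - x) *\<^sub>R f x) \<le> e * norm (y - x)"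
        using \<open>d1 > 0\<close> \<open>d2 > 0\<close> by (intro exI[of _ "min d1 d2"]) simp
    qed
  qed
qed

text \<open>The clamped curve is absolutely continuous on the line. Each coordinate is a difference
  of monotone functions with densities, the coordinate densities combine to \<open>h\<close>, and
  differentiation of the integral shows that \<open>h\<close> is the derivative off a null set. Both
  claims then pass from \<open>h\<close> to \<open>D\<close>.\<close>

theorem abs_continuous_on_vector_derivative:
  fixes y :: "real \<Rightarrow> 'a::euclidean_space"
  assumes ac: "abs_continuous_on {c..d} y"
  defines "D \<equiv> \<lambda>s. vector_derivative y (at s within {c..d})"
  shows "D absolutely_integrable_on {c..d}"
    and "\<And>u v. \<lbrakk>c \<le> u; u \<le> v; v \<le> d\<rbrakk> \<Longrightarrow> (D has_integral y v - y u) {u..v}"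
proof -
  have "D absolutely_integrable_on {c..d} \<and>
      (\<forall>u v. c \<le> u \<longrightarrow> u \<le> v \<longrightarrow> v \<le> d \<longrightarrow> (D has_integral y v - y u) {u..v})"
  proof (cases "c < d")
    case True
    define Y where "Y x = y (max c (min d x))" for x
    have acY: "abs_continuous_on UNIV Y"
      unfolding Y_def using True by (intro abs_continuous_on_clamp ac) simp
    have "\<exists>f. f absolutely_integrable_on {c..d} \<and>
        (\<forall>u v. u \<le> v \<longrightarrow> (f has_integral Y v \<bullet> i - Y u \<bullet> i) {u..v})" if "i \<in> Basis" for i :: 'a
    proof -
      have "abs_continuous_on UNIV (\<lambda>x. Y x \<bullet> i)"
        using Basis_le_norm[OF that]
        by (intro abs_continuous_on_norm_le[OF acY]) (simp add: inner_diff_left[symmetric])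
      then obtain F G where FG: "mono F" "mono G" "abs_continuous_on UNIV F"
          "abs_continuous_on UNIV G" "\<And>x. Y x \<bullet> i = F x - G x"
        using True by (rule abs_continuous_Jordan_decomposition) (auto simp: Y_def max_def min_def)
      obtain f where f: "\<And>x. f x \<ge> 0" "\<And>u v. u \<le> v \<Longrightarrow> (f has_integral F v - F u) {u..v}"
        using mono_abs_continuous_density[OF FG(1,3)] by blast
      obtain g where g: "\<And>x. g x \<ge> 0" "\<And>u v. u \<le> v \<Longrightarrow> (g has_integral G v - G u) {u..v}"
        using mono_abs_continuous_density[OF FG(2,4)] by blast
      have "(\<lambda>x. f x - g x) absolutely_integrable_on {c..d}"
        using f(1) g(1) has_integral_integrable[OF f(2)[of c d]] has_integral_integrable[OF g(2)[of c d]] True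
        by (intro set_integral_diff nonnegative_absolutely_integrable_1) auto
      moreover have "((\<lambda>x. f x - g x) has_integral Y v \<bullet> i - Y u \<bullet> i) {u..v}" if "u \<le> v" for u v
        using has_integral_diff[OF f(2)[OF that] g(2)[OF that]] by (simp add: FG(5) algebra_simps)
      ultimately show ?thesis by blast
    qed
    then obtain f where f: "\<And>i. i \<in> Basis \<Longrightarrow> f i absolutely_integrable_on {c..d}"
      "\<And>i u v. i \<in> Basis \<Longrightarrow> u \<le> v \<Longrightarrow> (f i has_integral Y v \<bullet> i - Y u \<bullet> i) {u..v}"
      by metis
    define h where "h x = (\<Sum>i\<in>Basis. f i x *\<^sub>R i)" for x
    have hi: "h x \<bullet> i = f i x" if "i \<in> Basis" for x i
      using that by (simp add: h_def inner_sum_left inner_Basis if_distrib cong: if_cong)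
    have h: "(h has_integral Y v - Y u) {u..v}" if "u \<le> v" for u v
      using f(2) that by (subst has_integral_componentwise_iff) (simp add: hi inner_diff_left)
    have hab: "h absolutely_integrable_on {c..d}"
      using f(1) by (subst absolutely_integrable_componentwise_iff) (simp add: hi)
    obtain N where N: "negligible N" "\<And>x. x \<notin> N \<Longrightarrow> (Y has_vector_derivative h x) (at x)"
      using indefinite_integral_has_vector_derivative_ae[OF h] by blast
    have Dh: "D s = h s" if "s \<in> {c..d} - N" for s
    proof -
      have "(Y has_vector_derivative h s) (at s within {c..d})"
        using N(2)[of s] that by (auto intro: has_vector_derivative_at_within)
      then have "(y has_vector_derivative h s) (at s within {c..d})"
        by (rule has_vector_derivative_transform[rotated 2]) (use that in \<open>auto simp: Y_def\<close>)
      then show ?thesis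
        unfolding D_def using True that by (intro vector_derivative_within_closed_interval) auto
    qed
    have "(D has_integral y v - y u) {u..v}" if "c \<le> u" "u \<le> v" "v \<le> d" for u v
    proof (rule has_integral_spike[OF N(1)])
      show "(h has_integral y v - y u) {u..v}"
        using h[OF that(2)] that by (simp add: Y_def min_absorb2 max_absorb2)
    qed (use Dh that in auto)
    moreover have "D absolutely_integrable_on {c..d}"
      using hab N(1) Dh by (rule absolutely_integrable_spike)
    ultimately show ?thesis by blast
  next
    \<comment> \<open>The interval is empty or a single point. Then \<open>u = v\<close>, and both
      the integral and the increment vanish.\<close>
    case False
    then have "negligible {c..d}"
      by (cases "c = d") auto
    then have "D absolutely_integrable_on {c..d}"
      by (rule absolutely_integrable_negligible)
    moreover have "u = v" if "c \<le> u" "u \<le> v" "v \<le> d" for u v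
      using False that by simp
    ultimately show ?thesis by fastforce
  qed
  then show "D absolutely_integrable_on {c..d}"
    and "\<And>u v. \<lbrakk>c \<le> u; u \<le> v; v \<le> d\<rbrakk> \<Longrightarrow> (D has_integral y v - y u) {u..v}"
    by blast+
qed

section \<open>The discounted cost\<close>

lemma enn2ereal_eq_ereal_enn2real: "x < \<infinity> \<Longrightarrow> enn2ereal x = ereal (enn2real x)"
  by (cases x rule: ennreal_cases) auto

lemma ext_integral_integrable:
  assumes "integrable M f"
  shows "ext_integral M f = ereal (integral\<^sup>L M f)"
proof -
  have "(\<integral>\<^sup>+x. ennreal (f x) \<partial>M) < \<infinity>" "(\<integral>\<^sup>+x. ennreal (- f x) \<partial>M) < \<infinity>"
    using assms unfolding real_integrable_def by (auto simp: less_top)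
  then show ?thesis
    unfolding ext_integral_def real_lebesgue_integral_def[OF assms]
    by (simp add: enn2ereal_eq_ereal_enn2real)
qed

text \<open>A lower bound on a space of finite measure makes the integral of the negative part
  finite, so failure of integrability must come from the positive part.\<close>

lemma ext_integral_not_integrable:
  assumes "f \<in> borel_measurable M" "\<not> integrable M f"
    and "emeasure M (space M) < \<infinity>" "\<And>x. x \<in> space M \<Longrightarrow> - c \<le> f x"
  shows "ext_integral M f = \<infinity>"
proof -
  have "(\<integral>\<^sup>+x. ennreal (- f x) \<partial>M) \<le> (\<integral>\<^sup>+x. ennreal c \<partial>M)"
    using assms(4) by (intro nn_integral_mono ennreal_leI) force
  also have "\<dots> < \<infinity>"
    using assms(3) by (simp add: ennreal_mult_less_top)
  finally have fin: "(\<integral>\<^sup>+x. ennreal (- f x) \<partial>M) < \<infinity>" by simp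
  then have "(\<integral>\<^sup>+x. ennreal (f x) \<partial>M) = \<infinity>"
    using assms(1,2) unfolding real_integrable_def by auto
  then show ?thesis
    unfolding ext_integral_def using fin by (simp add: enn2ereal_eq_ereal_enn2real)
qed

lemma integrable_lebesgue_on_iff:
  fixes f :: "'a::euclidean_space \<Rightarrow> 'b::euclidean_space"
  assumes "S \<in> sets lebesgue"
  shows "integrable (lebesgue_on S) f \<longleftrightarrow> f absolutely_integrable_on S"
  using assms by (simp add: set_integrable_def integrable_restrict_space)

text \<open>Outside a large ball the growth condition gives the bound with no constant. On the ball,
  compactness supplies \<open>C\<close>. The radius \<open>max R 1\<close> keeps \<open>u\<close>
  away from \<open>0\<close> outside the ball, so that the quotient can be cleared.\<close>

lemma superlinear_lower_bound:
  fixes l :: "'a::euclidean_space \<Rightarrow> real"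
  assumes "continuous_on UNIV l" "filterlim (\<lambda>u. l u / norm u) at_top at_infinity"
  obtains C where "C \<ge> 0" "\<And>u. A * norm u - C \<le> l u"
proof -
  have "\<forall>\<^sub>F u in at_infinity. A \<le> l u / norm u"
    using assms(2) unfolding filterlim_at_top by blast
  then obtain R where R: "\<And>u. norm u \<ge> R \<Longrightarrow> A \<le> l u / norm u"
    unfolding eventually_at_infinity by auto
  define k where "k u = l u - A * norm u" for u
  have "continuous_on (cball 0 (max R 1)) k"
    unfolding k_def by (intro continuous_intros continuous_on_subset[OF assms(1)]) auto
  then have "compact (k ` cball 0 (max R 1))"
    by (intro compact_continuous_image) auto
  then obtain m where m: "\<And>u. u \<in> cball 0 (max R 1) \<Longrightarrow> m \<le> k u"
    using compact_imp_bounded bounded_imp_bdd_below unfolding bdd_below_def by (metis imageI)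
  show thesis
  proof
    show "0 \<le> max 0 (- m)" by simp
    fix u
    show "A * norm u - max 0 (- m) \<le> l u"
    proof (cases "u \<in> cball 0 (max R 1)")
      case True
      then show ?thesis using m[OF True] by (simp add: k_def)
    next
      case False
      then have "norm u \<ge> R" "norm u > 0" by auto
      then have "A * norm u \<le> l u"
        using R[of u] by (simp add: pos_le_divide_eq)
      then show ?thesis by simp
    qed
  qed
qed

text \<open>With slope \<open>(K + 1) / a\<close> in \<open>l_lower\<close> the running cost, discounted by at least \<open>a\<close>, outweighs the
  terminal cost, and the surplus \<open>1\<close> controls the displacement of nearly optimal curves.\<close>

locale discounted_problem =
  fixes l g :: "real ^ 'n \<Rightarrow> real" and d :: "real \<Rightarrow> real \<Rightarrow> real" and a T K L C :: real
  assumes T_pos: "T > 0" and a_pos: "a > 0" and K_nonneg: "K \<ge> 0" and L_nonneg: "L \<ge> 0"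
    and C_nonneg: "C \<ge> 0"
    and l_cont: "continuous_on UNIV l"
    and l_lower: "\<And>u. (K + 1) / a * norm u - C \<le> l u"
    and g_lip: "\<And>x y. \<bar>g x - g y\<bar> \<le> K * norm (x - y)"
    and d_bounds: "\<And>t s. t \<in> {0..T} \<Longrightarrow> s \<in> {0..T} \<Longrightarrow> a \<le> d t s \<and> d t s \<le> 1"
    and d_lip: "\<And>t t' s. t \<in> {0..T} \<Longrightarrow> t' \<in> {0..T} \<Longrightarrow> s \<in> {0..T} \<Longrightarrow>
      \<bar>d t s - d t' s\<bar> \<le> L * \<bar>t - t'\<bar>"
    and d_cont: "\<And>t. t \<in> {0..T} \<Longrightarrow> continuous_on {0..T} (d t)"
begin

section \<open>Velocities and costs of curves\<close>

definition vel :: "real \<Rightarrow> (real \<Rightarrow> real ^ 'n) \<Rightarrow> real \<Rightarrow> real ^ 'n" where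
  "vel t y s = vector_derivative y (at s within {t..T})"

text \<open>Stated without the discount, which lies between \<open>a\<close> and \<open>1\<close>.
  The condition can therefore be used with the weights of different initial times.\<close>

definition finite_cost :: "real \<Rightarrow> (real \<Rightarrow> real ^ 'n) \<Rightarrow> bool" where
  "finite_cost t y \<longleftrightarrow> (\<lambda>s. l (vel t y s)) absolutely_integrable_on {t..T}"

definition real_cost :: "real \<Rightarrow> (real \<Rightarrow> real ^ 'n) \<Rightarrow> real" where
  "real_cost t y = integral {t..T} (\<lambda>s. d t s * l (vel t y s)) + d t T * g (y T)"

lemma vel_integral:
  assumes "y \<in> AC_curves T x t"
  shows "vel t y absolutely_integrable_on {t..T}"
    and "\<And>u v. \<lbrakk>t \<le> u; u \<le> v; v \<le> T\<rbrakk> \<Longrightarrow> (vel t y has_integral y v - y u) {u..v}"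
  using abs_continuous_on_vector_derivative[of t T y] assms
  by (auto simp: AC_curves_def vel_def[abs_def])

lemma l_ge: "- C \<le> l u"
proof -
  have "0 \<le> (K + 1) / a * norm u"
    using K_nonneg a_pos by simp
  then show ?thesis using l_lower[of u] by linarith
qed

text \<open>Since \<open>l + C\<close> is nonnegative, raising the weight from \<open>a\<close> to
  \<open>\<delta>\<close> can only increase the product, and \<open>\<delta> * C\<close> is at most
  \<open>C\<close>. The factor \<open>a\<close> cancels the denominator in
  \<open>l_lower\<close>.\<close>

lemma weighted_lower:
  assumes "\<delta> \<ge> a" "\<delta> \<le> 1"
  shows "(K + 1) * norm u - C \<le> \<delta> * l u"
proof -
  have "(K + 1) * norm u = a * ((K + 1) / a * norm u)"
    using a_pos by simp
  also have "\<dots> \<le> a * (l u + C)"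
    using l_lower[of u] a_pos by (intro mult_left_mono) auto
  also have "\<dots> \<le> \<delta> * (l u + C)"
    using assms l_ge[of u] by (intro mult_right_mono) auto
  also have "\<dots> \<le> \<delta> * l u + C"
    using mult_right_mono[OF assms(2) C_nonneg] by (simp add: algebra_simps)
  finally show ?thesis by simp
qed

text \<open>Controls the undiscounted \<open>\<bar>l u\<bar>\<close> by the discounted integrand.
  This is what a change of the discount weight has to be measured against.\<close>

lemma abs_l_le:
  assumes "\<delta> \<ge> a" "\<delta> \<le> 1"
  shows "\<bar>l u\<bar> \<le> (\<delta> * l u + C) / a + C"
proof -
  have "a * (l u + C) \<le> \<delta> * (l u + C)"
    using assms l_ge[of u] by (intro mult_right_mono) auto
  also have "\<dots> \<le> \<delta> * l u + C"
    using mult_right_mono[OF assms(2) C_nonneg] by (simp add: algebra_simps)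
  finally have "l u + C \<le> (\<delta> * l u + C) / a"
    using a_pos by (simp add: pos_le_divide_eq mult.commute)
  then show ?thesis using l_ge[of u] C_nonneg by (simp add: abs_if)
qed

lemma d_meas:
  assumes "\<tau> \<in> {0..T}" "0 \<le> u" "v \<le> T"
  shows "d \<tau> \<in> borel_measurable (lebesgue_on {u..v})"
  using assms by (intro continuous_imp_measurable_on_sets_lebesgue continuous_on_subset[OF d_cont]) auto

lemma weighted_integrable:
  fixes k :: "real \<Rightarrow> real"
  assumes "k absolutely_integrable_on {u..v}" "\<tau> \<in> {0..T}" "0 \<le> u" "v \<le> T"
  shows "(\<lambda>s. d \<tau> s * k s) absolutely_integrable_on {u..v}"
proof (rule absolutely_integrable_bounded_measurable_product_real)
  show "bounded (d \<tau> ` {u..v})"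
    using assms by (intro compact_imp_bounded compact_continuous_image
        continuous_on_subset[OF d_cont]) auto
qed (use assms d_meas in auto)

lemma finite_cost_subinterval:
  assumes "finite_cost t y" "t \<le> u" "v \<le> T"
  shows "(\<lambda>s. l (vel t y s)) absolutely_integrable_on {u..v}"
  using assms unfolding finite_cost_def by (rule_tac set_integrable_subset) auto

lemma cost_finite:
  assumes "finite_cost t y" "t \<in> {0..T}"
  shows "cost T d l g t y = ereal (real_cost t y)"
proof -
  have "(\<lambda>s. d t s * l (vel t y s)) absolutely_integrable_on {t..T}"
    using assms by (intro weighted_integrable) (auto simp: finite_cost_def)
  then have "integrable (lebesgue_on {t..T}) (\<lambda>s. d t s * l (vel t y s))"
    by (simp add: integrable_lebesgue_on_iff)
  then show ?thesis
    unfolding cost_def real_cost_def vel_def[symmetric]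
    by (simp add: ext_integral_integrable lebesgue_integral_eq_integral)
qed

text \<open>As the weight is at least \<open>a\<close>, discounting cannot restore integrability,
  while the integrand stays bounded below by \<open>- C\<close>. Curves without
  \<open>finite_cost\<close> thus never matter for the infimum.\<close>

lemma cost_not_finite:
  assumes y: "y \<in> AC_curves T x t" and "\<not> finite_cost t y" and t: "t \<in> {0..T}"
  shows "cost T d l g t y = \<infinity>"
proof -
  let ?M = "lebesgue_on {t..T}" and ?f = "\<lambda>s. d t s * l (vel t y s)"
  have "vel t y \<in> borel_measurable ?M"
    using vel_integral(1)[OF y] by (auto dest: absolutely_integrable_imp_borel_measurable)
  then have lm: "(\<lambda>s. l (vel t y s)) \<in> borel_measurable ?M"
    by (rule measurable_compose[OF _ borel_measurable_continuous_onI[OF l_cont]])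
  have fm: "?f \<in> borel_measurable ?M"
    using lm d_meas[of t t T] t by (intro borel_measurable_times) auto
  have "\<not> integrable ?M ?f"
  proof
    assume "integrable ?M ?f"
    then have "integrable ?M (\<lambda>s. inverse a * ?f s)"
      by simp
    then have "integrable ?M (\<lambda>s. l (vel t y s))"
    proof (rule Bochner_Integration.integrable_bound[OF _ lm AE_I2])
      fix s assume "s \<in> space ?M"
      then have "a \<le> d t s" using d_bounds[of t s] t by auto
      then have "a * \<bar>l (vel t y s)\<bar> \<le> \<bar>?f s\<bar>"
        using a_pos by (simp add: abs_mult mult_right_mono)
      then show "norm (l (vel t y s)) \<le> norm (inverse a * ?f s)"
        using a_pos by (simp add: abs_mult field_simps)
    qed
    with assms(2) show False
      by (simp add: finite_cost_def integrable_lebesgue_on_iff)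
  qed
  moreover have "- C \<le> ?f s" if "s \<in> space ?M" for s
  proof -
    have "0 \<le> (K + 1) * norm (vel t y s)"
      using K_nonneg by simp
    then show ?thesis
      using weighted_lower[of "d t s" "vel t y s"] d_bounds[of t s] that t by fastforce
  qed
  ultimately have "ext_integral ?M ?f = \<infinity>"
    using fm by (intro ext_integral_not_integrable[where c = C])
      (auto simp: emeasure_restrict_space emeasure_lborel_Icc_eq)
  then show ?thesis
    unfolding cost_def vel_def[symmetric] by simp
qed

section \<open>Coercivity and change of discount\<close>

text \<open>Integrate \<open>weighted_lower\<close>. The fundamental theorem of calculus bounds the
  displacement by the integral of the speed.\<close>

lemma running_cost_lower:
  assumes y: "y \<in> AC_curves T x t" "finite_cost t y" and t: "t \<in> {0..T}"
    and uv: "t \<le> u" "u \<le> v" "v \<le> T"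
  shows "(K + 1) * norm (y v - y u) - C * (v - u) \<le> integral {u..v} (\<lambda>s. d t s * l (vel t y s))"
proof -
  have va: "vel t y absolutely_integrable_on {u..v}"
    using vel_integral(1)[OF y(1)] uv by (rule_tac set_integrable_subset) auto
  then have nv: "(\<lambda>s. norm (vel t y s)) integrable_on {u..v}"
    by (simp add: absolutely_integrable_on_def)
  then have knv: "(\<lambda>s. (K + 1) * norm (vel t y s)) integrable_on {u..v}"
    using integrable_cmul[of "\<lambda>s. norm (vel t y s)" "{u..v}" "K + 1"] by simp
  have "norm (y v - y u) = norm (integral {u..v} (vel t y))"
    using vel_integral(2)[OF y(1) uv] by (simp add: integral_unique)
  also have "\<dots> \<le> integral {u..v} (\<lambda>s. norm (vel t y s))"
    using va nv by (intro integral_norm_bound_integral) (auto simp: absolutely_integrable_on_def)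
  finally have "(K + 1) * norm (y v - y u) - C * (v - u)
      \<le> (K + 1) * integral {u..v} (\<lambda>s. norm (vel t y s)) - C * (v - u)"
    using K_nonneg by (simp add: mult_left_mono)
  also have "\<dots> = integral {u..v} (\<lambda>s. (K + 1) * norm (vel t y s) - C)"
    using knv uv(2) by (subst integral_diff) auto
  also have "\<dots> \<le> integral {u..v} (\<lambda>s. d t s * l (vel t y s))"
  proof (rule integral_le)
    show "(\<lambda>s. (K + 1) * norm (vel t y s) - C) integrable_on {u..v}"
      using knv by (intro integrable_diff) auto
    show "(\<lambda>s. d t s * l (vel t y s)) integrable_on {u..v}"
      using weighted_integrable[OF finite_cost_subinterval[OF y(2) uv(1,3)] t _ uv(3)] t uv
      by (simp add: absolutely_integrable_on_def)
    show "(K + 1) * norm (vel t y s) - C \<le> d t s * l (vel t y s)" if "s \<in> {u..v}" for s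
      using that t uv d_bounds[of t s] by (intro weighted_lower) auto
  qed
  finally show ?thesis .
qed

lemma abs_terminal_le:
  assumes "t \<in> {0..T}"
  shows "\<bar>d t T * g z\<bar> \<le> \<bar>g z\<bar>"
  using d_bounds[of t T] assms T_pos a_pos by (auto simp: abs_mult intro!: mult_left_le_one_le)

lemma weighted_terminal_diff:
  assumes "t \<in> {0..T}"
  shows "d t T * (g (z + w) - g z) \<le> K * norm w"
proof -
  have "d t T * (g (z + w) - g z) \<le> d t T * \<bar>g (z + w) - g z\<bar>"
    using d_bounds[of t T] assms T_pos a_pos by (intro mult_left_mono) auto
  also have "\<dots> \<le> 1 * (K * norm w)"
    using d_bounds[of t T] assms T_pos g_lip[of "z + w" z] by (intro mult_mono) auto
  finally show ?thesis by simp
qed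

lemma weighted_terminal_change:
  assumes "t \<in> {0..T}" "t' \<in> {0..T}"
  shows "\<bar>d t T * g z - d t' T * g z\<bar> \<le> L * \<bar>t - t'\<bar> * \<bar>g z\<bar>"
proof -
  have "\<bar>d t T * g z - d t' T * g z\<bar> = \<bar>d t T - d t' T\<bar> * \<bar>g z\<bar>"
    by (simp add: abs_mult[symmetric] left_diff_distrib)
  also have "\<dots> \<le> L * \<bar>t - t'\<bar> * \<bar>g z\<bar>"
    using d_lip[of t t' T] assms T_pos by (intro mult_right_mono) auto
  finally show ?thesis .
qed

text \<open>The running cost controls the displacement with factor \<open>K + 1\<close>, and the
  terminal cost can undo at most \<open>K\<close> of it. A factor \<open>1\<close> remains.\<close>

lemma endpoint_bound:
  assumes y: "y \<in> AC_curves T x t" "finite_cost t y" and t: "t \<in> {0..T}"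
  shows "norm (y T - x) \<le> real_cost t y + C * T + \<bar>g x\<bar>"
proof -
  have "y t = x" using y(1) by (simp add: AC_curves_def)
  have "(K + 1) * norm (y T - x) - C * (T - t) \<le> integral {t..T} (\<lambda>s. d t s * l (vel t y s))"
    using running_cost_lower[OF y t, of t T] t \<open>y t = x\<close> by simp
  moreover have "\<bar>g (y T)\<bar> \<le> \<bar>g x\<bar> + K * norm (y T - x)"
    using g_lip[of "y T" x] by linarith
  moreover have "C * (T - t) \<le> C * T"
    using C_nonneg t by (intro mult_left_mono) auto
  ultimately show ?thesis
    using abs_terminal_le[OF t, of "y T"] unfolding real_cost_def by (simp add: algebra_simps)
qed

text \<open>Integrate \<open>abs_l_le\<close>; the running cost is at most the total cost plus the
  modulus of the terminal datum.\<close>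

lemma integral_abs_l_bound:
  assumes y: "y \<in> AC_curves T x t" "finite_cost t y" and t: "t \<in> {0..T}"
  shows "integral {t..T} (\<lambda>s. \<bar>l (vel t y s)\<bar>)
    \<le> (real_cost t y + \<bar>g (y T)\<bar> + C * T) / a + C * T"
proof -
  have int: "(\<lambda>s. d t s * l (vel t y s)) integrable_on {t..T}"
    using weighted_integrable[OF y(2)[unfolded finite_cost_def] t] t
    by (simp add: absolutely_integrable_on_def)
  have "integral {t..T} (\<lambda>s. \<bar>l (vel t y s)\<bar>)
      \<le> integral {t..T} (\<lambda>s. (d t s * l (vel t y s) + C) / a + C)"
  proof (rule integral_le)
    show "(\<lambda>s. \<bar>l (vel t y s)\<bar>) integrable_on {t..T}"
      using y(2) by (simp add: finite_cost_def absolutely_integrable_on_def)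
    show "(\<lambda>s. (d t s * l (vel t y s) + C) / a + C) integrable_on {t..T}"
      using int by (intro integrable_add integrable_on_divide) auto
    show "\<bar>l (vel t y s)\<bar> \<le> (d t s * l (vel t y s) + C) / a + C" if "s \<in> {t..T}" for s
      using that t d_bounds[of t s] by (intro abs_l_le) auto
  qed
  also have "\<dots> = (integral {t..T} (\<lambda>s. d t s * l (vel t y s)) + C * (T - t)) / a + C * (T - t)"
  proof (rule integral_unique)
    have "((\<lambda>s. C) has_integral C * (T - t)) {t..T}"
      using has_integral_const_real[of C t T] t by (simp add: mult.commute)
    then show "((\<lambda>s. (d t s * l (vel t y s) + C) / a + C) has_integral
        (integral {t..T} (\<lambda>s. d t s * l (vel t y s)) + C * (T - t)) / a + C * (T - t)) {t..T}"
      by (intro has_integral_add has_integral_divide integrable_integral int)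
  qed
  also have "\<dots> \<le> (real_cost t y + \<bar>g (y T)\<bar> + C * T) / a + C * T"
  proof -
    have "C * (T - t) \<le> C * T"
      using C_nonneg t by (intro mult_left_mono) auto
    then show ?thesis
      using abs_terminal_le[OF t, of "y T"] a_pos unfolding real_cost_def
      by (intro add_mono divide_right_mono) auto
  qed
  finally show ?thesis .
qed

lemma weight_change:
  fixes k :: "real \<Rightarrow> real"
  assumes k: "k absolutely_integrable_on {t..T}" and "\<tau> \<in> {0..T}" "\<tau>' \<in> {0..T}"
    and uv: "0 \<le> t" "t \<le> u" "u \<le> T"
  shows "\<bar>integral {u..T} (\<lambda>s. d \<tau> s * k s) - integral {u..T} (\<lambda>s. d \<tau>' s * k s)\<bar>
    \<le> L * \<bar>\<tau> - \<tau>'\<bar> * integral {t..T} (\<lambda>s. \<bar>k s\<bar>)"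
proof -
  have ku: "k absolutely_integrable_on {u..T}"
    using k by (rule set_integrable_subset) (use uv in auto)
  have ints: "(\<lambda>s. d \<tau> s * k s) integrable_on {u..T}" "(\<lambda>s. d \<tau>' s * k s) integrable_on {u..T}"
    using weighted_integrable[OF ku] assms by (auto simp: absolutely_integrable_on_def)
  have ak: "(\<lambda>s. \<bar>k s\<bar>) integrable_on {u..T}" "(\<lambda>s. \<bar>k s\<bar>) integrable_on {t..T}"
    using ku k by (auto simp: absolutely_integrable_on_def)
  have "\<bar>integral {u..T} (\<lambda>s. d \<tau> s * k s) - integral {u..T} (\<lambda>s. d \<tau>' s * k s)\<bar>
      = norm (integral {u..T} (\<lambda>s. d \<tau> s * k s - d \<tau>' s * k s))"
    using ints by (simp add: integral_diff)
  also have "\<dots> \<le> integral {u..T} (\<lambda>s. L * \<bar>\<tau> - \<tau>'\<bar> * \<bar>k s\<bar>)"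
  proof (rule integral_norm_bound_integral)
    show "norm (d \<tau> s * k s - d \<tau>' s * k s) \<le> L * \<bar>\<tau> - \<tau>'\<bar> * \<bar>k s\<bar>" if "s \<in> {u..T}" for s
    proof -
      have "\<bar>d \<tau> s - d \<tau>' s\<bar> * \<bar>k s\<bar> \<le> L * \<bar>\<tau> - \<tau>'\<bar> * \<bar>k s\<bar>"
        using that assms by (intro mult_right_mono d_lip) auto
      then show ?thesis
        by (simp add: abs_mult[symmetric] left_diff_distrib)
    qed
    show "(\<lambda>s. L * \<bar>\<tau> - \<tau>'\<bar> * \<bar>k s\<bar>) integrable_on {u..T}"
      using integrable_cmul[OF ak(1), of "L * \<bar>\<tau> - \<tau>'\<bar>"] by simp
  qed (use ints in \<open>auto intro: integrable_diff\<close>)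
  also have "\<dots> = L * \<bar>\<tau> - \<tau>'\<bar> * integral {u..T} (\<lambda>s. \<bar>k s\<bar>)"
    by simp
  also have "\<dots> \<le> L * \<bar>\<tau> - \<tau>'\<bar> * integral {t..T} (\<lambda>s. \<bar>k s\<bar>)"
    using ak uv L_nonneg by (intro mult_left_mono integral_subset_le) auto
  finally show ?thesis .
qed

section \<open>Translated, extended and restricted curves\<close>

text \<open>\<open>vector_derivative\<close> is a choice. Showing that both curves have exactly the
  same derivatives gives equality also at points where none exists.\<close>

lemma vel_translate: "vel t (\<lambda>s. y s + c) = vel t y"
proof -
  have "((\<lambda>s. y s + c) has_vector_derivative f') F \<longleftrightarrow> (y has_vector_derivative f') F" for f' F
    using has_vector_derivative_add[OF _ has_vector_derivative_const[of c], of y f' F]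
      has_vector_derivative_add[OF _ has_vector_derivative_const[of "- c"], of "\<lambda>s. y s + c" f' F]
    by auto
  then show ?thesis
    by (simp add: vel_def[abs_def] vector_derivative_def)
qed

text \<open>The point \<open>t'\<close> is excluded because there the derivative within
  \<open>{t'..T}\<close> is one-sided, while within \<open>{t..T}\<close> it may be
  two-sided.\<close>

lemma vel_restrict:
  assumes "t \<le> t'" "s \<in> {t'<..T}" and eq: "\<And>r. r \<in> {t'..T} \<Longrightarrow> y r = z r"
  shows "vel t y s = vel t' z s"
proof -
  have "at s within {t..T} = at s within {t'..T}"
    by (rule at_within_nhd[of s "{t'<..}"]) (use assms in auto)
  moreover have "vector_derivative y (at s within {t'..T}) = vector_derivative z (at s within {t'..T})"
    using assms by (intro vector_derivative_cong_eq) auto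
  ultimately show ?thesis by (simp add: vel_def)
qed

text \<open>At \<open>t'\<close> the curve may start to move, so the constancy on
  \<open>{t..t'}\<close> determines the velocity before \<open>t'\<close>.\<close>

lemma vel_constant:
  assumes "t < t'" "t' \<le> T" "s \<in> {t..<t'}" and eq: "\<And>r. r \<in> {t..t'} \<Longrightarrow> y r = x"
  shows "vel t y s = 0"
proof -
  have "at s within {t..T} = at s within {t..t'}"
    by (rule at_within_nhd[of s "{..<t'}"]) (use assms in auto)
  moreover have "((\<lambda>_. x) has_vector_derivative 0) (at s within {t..t'})"
    by (rule has_vector_derivative_const)
  then have "(y has_vector_derivative 0) (at s within {t..t'})"
    by (rule has_vector_derivative_transform[rotated 2]) (use assms in auto)
  then have "vector_derivative y (at s within {t..t'}) = 0"
    using assms by (intro vector_derivative_within_closed_interval) auto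
  ultimately show ?thesis by (simp add: vel_def)
qed

lemma translate_curve:
  assumes "y \<in> AC_curves T x t" "finite_cost t y" and t: "t \<in> {0..T}"
  shows "(\<lambda>s. y s + (x' - x)) \<in> AC_curves T x' t" "finite_cost t (\<lambda>s. y s + (x' - x))"
    and "real_cost t (\<lambda>s. y s + (x' - x)) \<le> real_cost t y + K * norm (x' - x)"
proof -
  show "(\<lambda>s. y s + (x' - x)) \<in> AC_curves T x' t"
    using assms(1) unfolding AC_curves_def by (auto intro: abs_continuous_on_norm_le)
  show "finite_cost t (\<lambda>s. y s + (x' - x))"
    using assms(2) by (simp add: finite_cost_def vel_translate)
  have "d t T * (g (y T + (x' - x)) - g (y T)) \<le> K * norm (x' - x)"
    by (rule weighted_terminal_diff[OF t])
  then show "real_cost t (\<lambda>s. y s + (x' - x)) \<le> real_cost t y + K * norm (x' - x)"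
    unfolding real_cost_def vel_translate by (simp add: algebra_simps)
qed

text \<open>The clamp makes the curve wait at \<open>x\<close> until \<open>t'\<close>, at a cost of
  at most \<open>(t' - t) * \<bar>l 0\<bar>\<close>. From \<open>t'\<close> on the velocity is that
  of \<open>y\<close>, except possibly at the single point \<open>t'\<close>, and the remaining
  error comes from replacing the weight \<open>d t'\<close> by \<open>d t\<close>.\<close>

lemma extend_curve:
  assumes y: "y \<in> AC_curves T x t'" "finite_cost t' y"
    and t: "t \<in> {0..T}" "t' \<in> {0..T}" "t \<le> t'"
  defines "z \<equiv> \<lambda>s. y (max t' (min T s))"
  shows "z \<in> AC_curves T x t" "finite_cost t z"
    and "real_cost t z \<le> real_cost t' y
      + (t' - t) * (\<bar>l 0\<bar> + L * (integral {t'..T} (\<lambda>s. \<bar>l (vel t' y s)\<bar>) + \<bar>g (y T)\<bar>))"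
proof -
  have acy: "abs_continuous_on {t'..T} y" and "y t' = x"
    using y(1) by (auto simp: AC_curves_def)
  have "abs_continuous_on {t..T} z"
    unfolding z_def using t
    by (intro abs_continuous_on_subset[OF abs_continuous_on_clamp[OF acy]]) auto
  moreover have "z t = x"
    using t \<open>y t' = x\<close> by (simp add: z_def)
  ultimately show "z \<in> AC_curves T x t"
    by (simp add: AC_curves_def)
  define k where "k s = l (vel t' y s)" for s
  define f where "f s = l (vel t z s)" for s
  have k: "k absolutely_integrable_on {t'..T}"
    using y(2) by (simp add: finite_cost_def k_def[abs_def])
  have f1: "f s = l 0" if "s \<in> {t..t'} - {t'}" for s
    using vel_constant[of t t' s z x] that t \<open>y t' = x\<close> by (auto simp: z_def f_def)
  have f2: "f s = k s" if "s \<in> {t'..T} - {t'}" for s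
    using vel_restrict[of t t' s z y] that t by (auto simp: z_def f_def k_def)
  have "f absolutely_integrable_on {t..t'}"
    by (rule absolutely_integrable_spike[where f = "\<lambda>_. l 0" and S = "{t'}"]) (use f1 in auto)
  moreover have "f absolutely_integrable_on {t'..T}"
    by (rule absolutely_integrable_spike[OF k, where S = "{t'}"]) (use f2 in auto)
  ultimately have "f absolutely_integrable_on {t..t'} \<union> {t'..T}"
    by (rule set_integrable_Un) auto
  also have "{t..t'} \<union> {t'..T} = {t..T}"
    using t by auto
  finally have f: "f absolutely_integrable_on {t..T}" .
  then show "finite_cost t z"
    by (simp add: finite_cost_def f_def[abs_def])
  have df: "(\<lambda>s. d t s * f s) integrable_on {t..T}"
    using weighted_integrable[OF f t(1)] t by (simp add: absolutely_integrable_on_def)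
  have "integral {t..t'} (\<lambda>s. d t s * f s) = integral {t..t'} (\<lambda>s. d t s * l 0)"
    by (rule integral_spike[of "{t'}"]) (use f1 in auto)
  also have "\<dots> \<le> integral {t..t'} (\<lambda>s. \<bar>l 0\<bar>)"
  proof (rule integral_le)
    show "(\<lambda>s. d t s * l 0) integrable_on {t..t'}"
      using t by (intro set_lebesgue_integral_eq_integral(1) weighted_integrable) auto
    show "d t s * l 0 \<le> \<bar>l 0\<bar>" if "s \<in> {t..t'}" for s
    proof -
      have "d t s * l 0 \<le> \<bar>d t s\<bar> * \<bar>l 0\<bar>"
        by (metis abs_ge_self abs_mult)
      also have "\<dots> \<le> 1 * \<bar>l 0\<bar>"
        using d_bounds[of t s] that t a_pos by (intro mult_right_mono) auto
      finally show ?thesis by simp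
    qed
  qed auto
  finally have 1: "integral {t..t'} (\<lambda>s. d t s * f s) \<le> (t' - t) * \<bar>l 0\<bar>"
    using t by simp
  have "integral {t'..T} (\<lambda>s. d t s * f s) = integral {t'..T} (\<lambda>s. d t s * k s)"
    by (rule integral_spike[of "{t'}"]) (use f2 in auto)
  also have "\<dots> \<le> integral {t'..T} (\<lambda>s. d t' s * k s)
      + L * (t' - t) * integral {t'..T} (\<lambda>s. \<bar>k s\<bar>)"
    using weight_change[OF k t(1,2) _ order_refl] t by (simp add: abs_le_iff)
  finally have 2: "integral {t'..T} (\<lambda>s. d t s * f s) \<le> integral {t'..T} (\<lambda>s. d t' s * k s)
      + L * (t' - t) * integral {t'..T} (\<lambda>s. \<bar>k s\<bar>)" .
  have 3: "d t T * g (y T) \<le> d t' T * g (y T) + L * (t' - t) * \<bar>g (y T)\<bar>"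
    using weighted_terminal_change[OF t(1,2), of "y T"] t by (simp add: abs_le_iff)
  have "integral {t..T} (\<lambda>s. d t s * f s)
      = integral {t..t'} (\<lambda>s. d t s * f s) + integral {t'..T} (\<lambda>s. d t s * f s)"
    using Henstock_Kurzweil_Integration.integral_combine[OF t(3) _ df] t by simp
  moreover have "z T = y T"
    using t by (simp add: z_def max_absorb2)
  ultimately show "real_cost t z \<le> real_cost t' y
      + (t' - t) * (\<bar>l 0\<bar> + L * (integral {t'..T} (\<lambda>s. \<bar>l (vel t' y s)\<bar>) + \<bar>g (y T)\<bar>))"
    using 1 2 3 unfolding real_cost_def f_def[symmetric] k_def[symmetric]
    by (simp add: algebra_simps)
qed

text \<open>Moving the restricted curve back to \<open>x\<close> raises the terminal cost by at most
  \<open>K * norm (y t' - x)\<close>. The dropped running cost on \<open>{t..t'}\<close> pays for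
  this up to \<open>C * (t' - t)\<close>; the \<open>L\<close> term accounts for the changed
  weight.\<close>

lemma restrict_curve:
  assumes y: "y \<in> AC_curves T x t" "finite_cost t y"
    and t: "t \<in> {0..T}" "t' \<in> {0..T}" "t \<le> t'"
  defines "z \<equiv> \<lambda>s. y s + (x - y t')"
  shows "z \<in> AC_curves T x t'" "finite_cost t' z"
    and "real_cost t' z \<le> real_cost t y
      + (t' - t) * (C + L * (integral {t..T} (\<lambda>s. \<bar>l (vel t y s)\<bar>) + \<bar>g (y T)\<bar>))"
proof -
  have acy: "abs_continuous_on {t..T} y" and "y t = x"
    using y(1) by (auto simp: AC_curves_def)
  have "abs_continuous_on {t'..T} z"
    unfolding z_def using t
    by (intro abs_continuous_on_norm_le[OF abs_continuous_on_subset[OF acy]]) auto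
  then show "z \<in> AC_curves T x t'"
    by (simp add: AC_curves_def z_def)
  define k where "k s = l (vel t y s)" for s
  define f where "f s = l (vel t' z s)" for s
  have k: "k absolutely_integrable_on {t..T}"
    using y(2) by (simp add: finite_cost_def k_def[abs_def])
  have k': "k absolutely_integrable_on {t'..T}"
    using finite_cost_subinterval[OF y(2) t(3) order_refl] by (simp add: k_def[abs_def])
  have fk: "f s = k s" if "s \<in> {t'..T} - {t'}" for s
    using vel_restrict[of t t' s y y] that t by (auto simp: z_def f_def k_def vel_translate)
  have "f absolutely_integrable_on {t'..T}"
    by (rule absolutely_integrable_spike[OF k', where S = "{t'}"]) (use fk in auto)
  then show "finite_cost t' z"
    by (simp add: finite_cost_def f_def[abs_def])
  have dk: "(\<lambda>s. d t s * k s) integrable_on {t..T}"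
    using weighted_integrable[OF k t(1)] t by (simp add: absolutely_integrable_on_def)
  have "integral {t'..T} (\<lambda>s. d t' s * f s) = integral {t'..T} (\<lambda>s. d t' s * k s)"
    by (rule integral_spike[of "{t'}"]) (use fk in auto)
  also have "\<dots> \<le> integral {t'..T} (\<lambda>s. d t s * k s)
      + L * (t' - t) * integral {t..T} (\<lambda>s. \<bar>k s\<bar>)"
    using weight_change[OF k t(2,1) _ t(3)] t by (simp add: abs_le_iff)
  finally have 1: "integral {t'..T} (\<lambda>s. d t' s * f s) \<le> integral {t'..T} (\<lambda>s. d t s * k s)
      + L * (t' - t) * integral {t..T} (\<lambda>s. \<bar>k s\<bar>)" .
  have "K * norm (y t' - x) \<le> (K + 1) * norm (y t' - x)"
    by (intro mult_right_mono) auto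
  then have 2: "K * norm (y t' - x) - C * (t' - t) \<le> integral {t..t'} (\<lambda>s. d t s * k s)"
    using running_cost_lower[OF y t(1), of t t'] t \<open>y t = x\<close> by (simp add: k_def)
  have 3: "d t' T * g (y T) \<le> d t T * g (y T) + L * (t' - t) * \<bar>g (y T)\<bar>"
    using weighted_terminal_change[OF t(2,1), of "y T"] t by (simp add: abs_le_iff)
  have 4: "d t' T * g (z T) \<le> d t' T * g (y T) + K * norm (y t' - x)"
    using weighted_terminal_diff[OF t(2), of "y T" "x - y t'"]
    by (simp add: z_def algebra_simps norm_minus_commute)
  have 5: "integral {t..T} (\<lambda>s. d t s * k s)
      = integral {t..t'} (\<lambda>s. d t s * k s) + integral {t'..T} (\<lambda>s. d t s * k s)"
    using Henstock_Kurzweil_Integration.integral_combine[OF t(3) _ dk] t by simp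
  show "real_cost t' z \<le> real_cost t y
      + (t' - t) * (C + L * (integral {t..T} (\<lambda>s. \<bar>l (vel t y s)\<bar>) + \<bar>g (y T)\<bar>))"
    using 1 2 3 4 5 unfolding real_cost_def f_def[symmetric] k_def[symmetric]
    by (simp add: algebra_simps)
qed

lemma terminal_curve:
  assumes "y \<in> AC_curves T x T"
  shows "finite_cost T y" "real_cost T y = d T T * g x"
proof -
  show "finite_cost T y"
    unfolding finite_cost_def by (rule absolutely_integrable_negligible) simp
  show "real_cost T y = d T T * g x"
    using assms by (simp add: real_cost_def AC_curves_def)
qed

lemma const_curve: "(\<lambda>_. x) \<in> AC_curves T x T"
  by (simp add: AC_curves_def abs_continuous_on_iff small_variation_def gt_ex)

text \<open>Bounds for curves whose cost is within \<open>1\<close> of the value, where \<open>|g x| \<le> r\<close> at the starting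
  point \<open>x\<close>. They depend on \<open>x\<close> only through \<open>r\<close>, hence are locally uniform.\<close>

definition cost_bound :: "real \<Rightarrow> real" where
  "cost_bound r = r + T * (\<bar>l 0\<bar> + L * r) + 1"

definition terminal_bound :: "real \<Rightarrow> real" where
  "terminal_bound r = r + K * (cost_bound r + C * T + r)"

definition running_bound :: "real \<Rightarrow> real" where
  "running_bound r = (cost_bound r + terminal_bound r + C * T) / a + C * T"

definition time_lip :: "real \<Rightarrow> real" where
  "time_lip r = \<bar>l 0\<bar> + C + L * (running_bound r + terminal_bound r)"

text \<open>The cost bounds the displacement, the displacement bounds the terminal datum, and the
  two together bound the integral of \<open>\<bar>l\<bar>\<close>.\<close>

lemma near_optimal_bounds:
  assumes y: "y \<in> AC_curves T x t" "finite_cost t y" and t: "t \<in> {0..T}"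
    and r: "\<bar>g x\<bar> \<le> r" and "real_cost t y \<le> cost_bound r"
  shows "\<bar>g (y T)\<bar> \<le> terminal_bound r"
    and "integral {t..T} (\<lambda>s. \<bar>l (vel t y s)\<bar>) \<le> running_bound r"
proof -
  have "norm (y T - x) \<le> cost_bound r + C * T + r"
    using endpoint_bound[OF y t] assms by linarith
  then have "K * norm (y T - x) \<le> K * (cost_bound r + C * T + r)"
    using K_nonneg by (rule mult_left_mono)
  then show *: "\<bar>g (y T)\<bar> \<le> terminal_bound r"
    using g_lip[of "y T" x] r unfolding terminal_bound_def by linarith
  have "(real_cost t y + \<bar>g (y T)\<bar> + C * T) / a \<le> (cost_bound r + terminal_bound r + C * T) / a"
    using * assms(5) a_pos by (intro divide_right_mono) auto
  then show "integral {t..T} (\<lambda>s. \<bar>l (vel t y s)\<bar>) \<le> running_bound r"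
    using integral_abs_l_bound[OF y t] unfolding running_bound_def by linarith
qed

section \<open>Finiteness and Lipschitz estimates of the value function\<close>

definition V :: "real ^ 'n \<Rightarrow> real \<Rightarrow> real" where
  "V x t = real_of_ereal (value_function T d l g x t)"

lemma value_le:
  assumes "y \<in> AC_curves T x t" "finite_cost t y" "t \<in> {0..T}"
  shows "value_function T d l g x t \<le> ereal (real_cost t y)"
  unfolding value_function_def cost_finite[OF assms(2,3), symmetric]
  using assms(1) by (rule INF_lower)

text \<open>The competitor is the constant curve, seen as the backward extension of a curve living
  at time \<open>T\<close>. The \<open>- 1\<close> leaves room for curves whose cost exceeds the
  value by up to \<open>1\<close>.\<close>

lemma value_upper:
  assumes t: "t \<in> {0..T}" and r: "\<bar>g x\<bar> \<le> r"
  shows "value_function T d l g x t \<le> ereal (cost_bound r - 1)"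
proof -
  have T: "T \<in> {0..T}" using T_pos by simp
  note ext = extend_curve[OF const_curve terminal_curve(1)[OF const_curve] t T, of x]
  have "d T T * g x \<le> r"
    using abs_terminal_le[OF T, of x] r by linarith
  moreover have "(T - t) * (\<bar>l 0\<bar> + L * \<bar>g x\<bar>) \<le> T * (\<bar>l 0\<bar> + L * r)"
    using t r L_nonneg by (intro mult_mono add_mono) auto
  ultimately have "real_cost t (\<lambda>s. x) \<le> cost_bound r - 1"
    using ext(3) t terminal_curve(2)[OF const_curve, of x] by (simp add: cost_bound_def)
  moreover have "value_function T d l g x t \<le> ereal (real_cost t (\<lambda>s. x))"
    using ext(1,2) t by (intro value_le) auto
  ultimately show ?thesis
    by (meson ereal_less_eq(3) order_trans)
qed

lemma value_lower:
  assumes t: "t \<in> {0..T}"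
  shows "ereal (- C * T - \<bar>g x\<bar>) \<le> value_function T d l g x t"
  unfolding value_function_def
proof (rule INF_greatest)
  fix y assume y: "y \<in> AC_curves T x t"
  show "ereal (- C * T - \<bar>g x\<bar>) \<le> cost T d l g t y"
  proof (cases "finite_cost t y")
    case True
    have "0 \<le> real_cost t y + C * T + \<bar>g x\<bar>"
      using endpoint_bound[OF y True t] norm_ge_zero order_trans by blast
    then show ?thesis
      by (simp add: cost_finite[OF True t])
  qed (simp add: cost_not_finite[OF y _ t])
qed

lemma value_finite:
  assumes "t \<in> {0..T}"
  shows "\<bar>value_function T d l g x t\<bar> \<noteq> \<infinity>"
  using value_upper[OF assms order_refl, of x] value_lower[OF assms, of x]
  by (cases "value_function T d l g x t") auto

lemma value_eq_V: "t \<in> {0..T} \<Longrightarrow> value_function T d l g x t = ereal (V x t)"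
  unfolding V_def using value_finite[of t x] by (simp add: ereal_real')

lemma V_le:
  assumes "y \<in> AC_curves T x t" "finite_cost t y" "t \<in> {0..T}"
  shows "V x t \<le> real_cost t y"
  using value_le[OF assms] value_eq_V[OF assms(3)] by simp

lemma V_near:
  assumes t: "t \<in> {0..T}" and "\<eta> > 0"
  obtains y where "y \<in> AC_curves T x t" "finite_cost t y" "real_cost t y < V x t + \<eta>"
proof -
  have "value_function T d l g x t < ereal (V x t + \<eta>)"
    using value_eq_V[OF t] \<open>\<eta> > 0\<close> by simp
  then obtain y where y: "y \<in> AC_curves T x t" and c: "cost T d l g t y < ereal (V x t + \<eta>)"
    unfolding value_function_def INF_less_iff by blast
  then have fin: "finite_cost t y"
    using cost_not_finite[OF y _ t] by force
  with c have "real_cost t y < V x t + \<eta>"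
    by (simp add: cost_finite[OF fin t])
  with y fin show thesis by (rule that)
qed

text \<open>Translate a nearly optimal curve from \<open>x\<close> to \<open>x'\<close> and let the
  error \<open>\<eta>\<close> tend to zero.\<close>

lemma V_space_lipschitz:
  assumes t: "t \<in> {0..T}"
  shows "V x' t \<le> V x t + K * norm (x' - x)"
proof (rule field_le_epsilon)
  fix \<eta> :: real assume "\<eta> > 0"
  obtain y where y: "y \<in> AC_curves T x t" "finite_cost t y" "real_cost t y < V x t + \<eta>"
    using V_near[OF t \<open>\<eta> > 0\<close>] .
  show "V x' t \<le> V x t + K * norm (x' - x) + \<eta>"
    using V_le[OF translate_curve(1,2)[OF y(1,2) t, of x'] t]
      translate_curve(3)[OF y(1,2) t, of x'] y(3) by linarith
qed

lemma V_near_bounds: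
  assumes t: "t \<in> {0..T}" and \<eta>: "\<eta> > 0" and r: "\<bar>g x\<bar> \<le> r"
  obtains y where "y \<in> AC_curves T x t" "finite_cost t y" "real_cost t y < V x t + \<eta>"
    "L * (integral {t..T} (\<lambda>s. \<bar>l (vel t y s)\<bar>) + \<bar>g (y T)\<bar>)
      \<le> L * (running_bound r + terminal_bound r)"
proof -
  \<comment> \<open>The cap at \<open>1\<close> brings the curve under \<open>cost_bound r\<close>,
    however large \<open>\<eta>\<close> is.\<close>
  have "min \<eta> 1 > 0" using \<eta> by simp
  then obtain y where y: "y \<in> AC_curves T x t" "finite_cost t y"
    "real_cost t y < V x t + min \<eta> 1"
    using V_near[OF t] by blast
  have "V x t \<le> cost_bound r - 1"
    using value_upper[OF t r] value_eq_V[OF t] by simp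
  then have "real_cost t y \<le> cost_bound r"
    using y(3) by linarith
  from near_optimal_bounds[OF y(1,2) t r this]
  have "L * (integral {t..T} (\<lambda>s. \<bar>l (vel t y s)\<bar>) + \<bar>g (y T)\<bar>)
      \<le> L * (running_bound r + terminal_bound r)"
    using L_nonneg by (intro mult_left_mono add_mono)
  with y show thesis by (intro that) auto
qed

text \<open>Backward extension of a nearly optimal curve from \<open>t'\<close> gives one
  inequality, and restriction of a nearly optimal curve from \<open>t\<close> gives the
  other.\<close>

lemma V_time_lipschitz:
  assumes t: "t \<in> {0..T}" "t' \<in> {0..T}" "t \<le> t'" and r: "\<bar>g x\<bar> \<le> r"
  shows "\<bar>V x t - V x t'\<bar> \<le> time_lip r * (t' - t)"
proof -
  have "V x t \<le> V x t' + time_lip r * (t' - t)"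
  proof (rule field_le_epsilon)
    fix \<eta> :: real assume "\<eta> > 0"
    obtain y where y: "y \<in> AC_curves T x t'" "finite_cost t' y" "real_cost t' y < V x t' + \<eta>"
      and b: "L * (integral {t'..T} (\<lambda>s. \<bar>l (vel t' y s)\<bar>) + \<bar>g (y T)\<bar>)
        \<le> L * (running_bound r + terminal_bound r)"
      using V_near_bounds[OF t(2) \<open>\<eta> > 0\<close> r] .
    note ext = extend_curve[OF y(1,2) t]
    have "(t' - t) * (\<bar>l 0\<bar> + L * (integral {t'..T} (\<lambda>s. \<bar>l (vel t' y s)\<bar>) + \<bar>g (y T)\<bar>))
        \<le> (t' - t) * time_lip r"
      using t b C_nonneg unfolding time_lip_def by (intro mult_left_mono) auto
    then show "V x t \<le> V x t' + time_lip r * (t' - t) + \<eta>"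
      using V_le[OF ext(1,2) t(1)] ext(3) y(3) mult.commute[of "t' - t" "time_lip r"] by linarith
  qed
  moreover have "V x t' \<le> V x t + time_lip r * (t' - t)"
  proof (rule field_le_epsilon)
    fix \<eta> :: real assume "\<eta> > 0"
    obtain y where y: "y \<in> AC_curves T x t" "finite_cost t y" "real_cost t y < V x t + \<eta>"
      and b: "L * (integral {t..T} (\<lambda>s. \<bar>l (vel t y s)\<bar>) + \<bar>g (y T)\<bar>)
        \<le> L * (running_bound r + terminal_bound r)"
      using V_near_bounds[OF t(1) \<open>\<eta> > 0\<close> r] .
    note res = restrict_curve[OF y(1,2) t]
    have "(t' - t) * (C + L * (integral {t..T} (\<lambda>s. \<bar>l (vel t y s)\<bar>) + \<bar>g (y T)\<bar>))
        \<le> (t' - t) * time_lip r"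
      using t b unfolding time_lip_def by (intro mult_left_mono) auto
    then show "V x t' \<le> V x t + time_lip r * (t' - t) + \<eta>"
      using V_le[OF res(1,2) t(2)] res(3) y(3) mult.commute[of "t' - t" "time_lip r"] by linarith
  qed
  ultimately show ?thesis by linarith
qed

lemma time_lip_nonneg:
  assumes "r \<ge> 0"
  shows "time_lip r \<ge> 0"
  using assms T_pos a_pos K_nonneg L_nonneg C_nonneg
  unfolding time_lip_def running_bound_def terminal_bound_def cost_bound_def
  by (intro add_nonneg_nonneg mult_nonneg_nonneg divide_nonneg_nonneg) auto

lemma locally_lipschitz_value:
  "locally_lipschitz_on (UNIV \<times> {0..T}) (\<lambda>(x, t). real_of_ereal (value_function T d l g x t))"
  unfolding locally_lipschitz_on_def V_def[symmetric]
proof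
  fix p :: "(real ^ 'n) \<times> real" assume "p \<in> UNIV \<times> {0..T}"
  \<comment> \<open>Bounds \<open>\<bar>g x\<bar>\<close> for every \<open>x\<close> within distance
    \<open>1\<close> of the space component of \<open>p\<close>, so one constant serves the whole
    unit ball.\<close>
  define r where "r = \<bar>g (fst p)\<bar> + K"
  have "(K + time_lip r)-lipschitz_on (cball p 1 \<inter> UNIV \<times> {0..T}) (\<lambda>(x, t). V x t)"
  proof (rule lipschitz_onI)
    have "r \<ge> 0" using K_nonneg by (simp add: r_def)
    then show "0 \<le> K + time_lip r"
      using K_nonneg time_lip_nonneg by simp
    fix q q' assume q: "q \<in> cball p 1 \<inter> UNIV \<times> {0..T}" and q': "q' \<in> cball p 1 \<inter> UNIV \<times> {0..T}"
    obtain x t x' t' where eq: "q = (x, t)" "q' = (x', t')"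
      by (cases q, cases q') auto
    have t: "t \<in> {0..T}" "t' \<in> {0..T}"
      using q q' by (auto simp: eq)
    have "norm (x - fst p) \<le> 1"
      using q dist_fst_le[of q p] by (simp add: eq dist_norm norm_minus_commute dist_commute)
    then have "K * norm (x - fst p) \<le> K * 1"
      using K_nonneg by (rule mult_left_mono)
    then have r: "\<bar>g x\<bar> \<le> r"
      using g_lip[of x "fst p"] by (simp add: r_def)
    \<comment> \<open>The two points are compared through the intermediate point
      \<open>(x, t')\<close>: first time changes, then space.\<close>
    have "\<bar>V x t - V x t'\<bar> \<le> time_lip r * \<bar>t - t'\<bar>"
      using V_time_lipschitz[OF t _ r] V_time_lipschitz[OF t(2,1) _ r]
      by (cases "t \<le> t'") (auto simp: abs_minus_commute)
    also have "\<dots> \<le> time_lip r * dist q q'"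
      using dist_snd_le[of q q'] time_lip_nonneg[OF \<open>r \<ge> 0\<close>]
      by (intro mult_left_mono) (auto simp: eq dist_real_def)
    finally have 1: "\<bar>V x t - V x t'\<bar> \<le> time_lip r * dist q q'" .
    have "\<bar>V x t' - V x' t'\<bar> \<le> K * norm (x - x')"
      using V_space_lipschitz[OF t(2), of x x'] V_space_lipschitz[OF t(2), of x' x]
      by (simp add: abs_le_iff norm_minus_commute)
    also have "\<dots> \<le> K * dist q q'"
      using dist_fst_le[of q q'] K_nonneg by (intro mult_left_mono) (auto simp: eq dist_norm)
    finally have 2: "\<bar>V x t' - V x' t'\<bar> \<le> K * dist q q'" .
    show "dist (case q of (x, t) \<Rightarrow> V x t) (case q' of (x, t) \<Rightarrow> V x t)
        \<le> (K + time_lip r) * dist q q'"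
      using 1 2 by (simp add: eq dist_real_def distrib_right)
  qed
  then show "\<exists>e>0. \<exists>L. L-lipschitz_on (cball p e \<inter> UNIV \<times> {0..T}) (\<lambda>(x, t). V x t)"
    by (intro exI[of _ 1] conjI exI[of _ "K + time_lip r"]) auto
qed

lemma value_terminal:
  assumes "d T T = 1"
  shows "value_function T d l g x T = ereal (g x)"
proof -
  have "cost T d l g T y = ereal (g x)" if "y \<in> AC_curves T x T" for y
    using terminal_curve[OF that] cost_finite[of T y] assms T_pos by simp
  then show ?thesis
    unfolding value_function_def using const_curve[of x] by (intro INF_eq_const) auto
qed

end

text \<open>The finiteness clause gives the Lipschitz clause its meaning, because
  \<open>real_of_ereal\<close> sends infinite values to \<open>0\<close>.\<close>

theorem theorem3p2:
  fixes l g :: "real ^ 'n \<Rightarrow> real" and d :: "real \<Rightarrow> real \<Rightarrow> real" and a T :: real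
  assumes "T > 0"
    and "C2 l"
    and "strictly_convex_on UNIV l"
    and "filterlim (\<lambda>u. l u / norm u) at_top at_infinity"
    and "\<exists>K. K-lipschitz_on UNIV g"
    and "a > 0"
    and "\<And>t s. t \<in> {0..T} \<Longrightarrow> s \<in> {0..T} \<Longrightarrow> d t s \<in> {a<..1}"
    and "\<exists>L. L-lipschitz_on ({0..T} \<times> {0..T}) (\<lambda>(t, s). d t s)"
    and "\<And>t. t \<in> {0..T} \<Longrightarrow> d t t = 1"
  shows "(\<forall>x. \<forall>t\<in>{0..T}. \<bar>value_function T d l g x t\<bar> \<noteq> \<infinity>) \<and>
    locally_lipschitz_on (UNIV \<times> {0..T}) (\<lambda>(x, t). real_of_ereal (value_function T d l g x t)) \<and>
    (\<forall>x. value_function T d l g x T = ereal (g x))"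
proof -
  obtain K where K: "K-lipschitz_on UNIV g"
    using assms(5) by blast
  obtain L where L: "L-lipschitz_on ({0..T} \<times> {0..T}) (\<lambda>(t, s). d t s)"
    using assms(8) by blast
  have l: "continuous_on UNIV l"
    using assms(2) unfolding C2_def
    by (metis continuous_at_imp_continuous_on has_derivative_continuous)
  obtain C where C: "C \<ge> 0" "\<And>u. (K + 1) / a * norm u - C \<le> l u"
    using superlinear_lower_bound[OF l assms(4), of "(K + 1) / a"] by blast
  interpret discounted_problem l g d a T K L C
  proof
    show "K \<ge> 0" "L \<ge> 0"
      using K L by (auto dest: lipschitz_on_nonneg)
    show "\<bar>g x - g y\<bar> \<le> K * norm (x - y)" for x y
      using lipschitz_onD[OF K, of x y] by (simp add: dist_norm)
    show "a \<le> d t s \<and> d t s \<le> 1" if "t \<in> {0..T}" "s \<in> {0..T}" for t s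
      using assms(7)[OF that] by simp
    show "\<bar>d t s - d t' s\<bar> \<le> L * \<bar>t - t'\<bar>" if "t \<in> {0..T}" "t' \<in> {0..T}" "s \<in> {0..T}" for t t' s
      using lipschitz_onD[OF L, of "(t, s)" "(t', s)"] that by (simp add: dist_Pair_Pair dist_real_def)
    show "continuous_on {0..T} (d t)" if "t \<in> {0..T}" for t
    proof (rule lipschitz_on_continuous_on[of L], rule lipschitz_onI)
      show "dist (d t s) (d t s') \<le> L * dist s s'" if "s \<in> {0..T}" "s' \<in> {0..T}" for s s'
        using lipschitz_onD[OF L, of "(t, s)" "(t, s')"] that \<open>t \<in> {0..T}\<close>
        by (simp add: dist_Pair_Pair)
    qed (use L in \<open>auto dest: lipschitz_on_nonneg\<close>)
  qed (use assms l C in auto)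
  show ?thesis
    using value_finite locally_lipschitz_value value_terminal assms(1,9) by simp
qed

end
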